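(* Let $t$, $v$, $k$, $\lambda$ and $s$ be positive integers such that $t < k < v$ and $s \leq \lfloor\frac{t}{2}\rfloor$. Let $b_{2s},b_{2s-1},\ldots,b_s$ be positive integers such that (i) $L_\lambda(v-2s,k-2s,t-2s) \leq b_{2s} \leq C_\lambda(v-2s,k-2s,t-2s)$; (ii) $\left\lceil \frac{v-i}{k-i}\, b_{i+1} \right\rceil \leq b_i \leq C_\lambda(v-i,k-i,t-i)$ for $i = 2s-1,2s-2,\ldots,s$; and (iii) $a_j \geq 0$ for $j \in \{0,\ldots,s\}$, where $a_j=\sum_{i=0}^j (-1)^{i+j}\binom{j}{i}b_{2s-i}$. Let $d=b_s\left(\binom{k}{s}-1\right)-\sum_{i=0}^{s-1}\binom{s}{i}\binom{v-s}{s-i}b_{2s-i}$ and let $d'=d+\binom{k}{s}-1$. Suppose that $b_s < \binom{k}{s}$ and that $d < a_s$. For real numbers $\alpha,\beta$ write \[CB_{(v,k,\lambda;s)}(\alpha,\beta) = \frac{b_s(\alpha-\beta)\binom{v}{s}+\alpha \binom{v}{s}}{(\alpha-\beta)\binom{k}{s}+1}.\] Then $C_\lambda(v,k,t) \geq \left\lceil CB_{(v,k,\lambda;s)}(\alpha,\beta)\right\rceil$ whenever one of the following holds. (a) $(\alpha,\beta)=\left(1-\frac{d^2}{2a_s(a_s+1)},\ \frac{a_s+2}{2(d'+1)}\right)$. (b) $(\alpha,\beta)=\left(1,\ 1-\frac{dd'}{a_s(a_s+1)}\right)$, $d \geq \frac{a_s}{2}$ and $dd' < a_s(a_s+1)$.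 (c) $(\alpha,\beta)=\left(1,\ \sqrt{\frac{d(a_s+2)}{(a_s+1)(a_s-d)}}-\frac{d(d'+1)}{2(a_s+1)(a_s-d)}\right)$, $d < \frac{a_s}{2}$ and $d(d'+1)^2 < 4(a_s+1)(a_s+2)(a_s-d)$.
   Context: An incidence structure is a pair $(V,\mathcal{B})$ where $V$ is a (finite) set of points and $\mathcal{B}$ is a multiset of subsets of $V$ called blocks (numbers of blocks are counted with multiplicity). For positive integers $t,v,k,\lambda$ with $t \leq k \leq v$, a $t$-$(v,k,\lambda)$ covering is an incidence structure $(V,\mathcal{B})$ such that $|V|=v$, $|B|=k$ for all $B\in\mathcal{B}$, and each $t$-subset of $V$ is contained in at least $\lambda$ blocks in $\mathcal{B}$. The covering number $C_\lambda(v,k,t)$ is the minimum number of blocks in any $t$-$(v,k,\lambda)$ covering; by convention $C_\lambda(v,k,0)=\lambda$ for all $v,k,\lambda$. For $t\ge 1$, \[L_{\lambda}(v,k,t) = \left\lceil\frac{v}{k} \left\lceil\frac{v-1}{k-1} \cdots \left\lceil\frac{v-t+2}{k-t+2} \left\lceil\frac{\lambda(v-t+1)}{k-t+1} \right\rceil \right\rceil \cdots \right\rceil \right\rceil\] (the Schönheim bound), and $L_\lambda(v,k,0)=\lambda$. *)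

theory Defs
  imports Complex_Main "HOL-Library.Multiset"
begin

definition incidence_structure :: "'a set \<Rightarrow> 'a set multiset \<Rightarrow> bool" where
  "incidence_structure V \<B> \<longleftrightarrow> finite V \<and> (\<forall>B \<in># \<B>. B \<subseteq> V)"

(* Meant for 1 <= t <= k <= v and 1 <= l, with l standing for lambda. *)
definition covering :: "nat \<Rightarrow> nat \<Rightarrow> nat \<Rightarrow> nat \<Rightarrow> 'a set \<Rightarrow> 'a set multiset \<Rightarrow> bool" where
  "covering t v k l V \<B> \<longleftrightarrow>
     incidence_structure V \<B> \<and> card V = v \<and> (\<forall>B \<in># \<B>. card B = k) \<and>
     (\<forall>T. T \<subseteq> V \<and> card T = t \<longrightarrow> l \<le> size {#B \<in># \<B>. T \<subseteq> B#})"

(* The points may be taken to be natural numbers since point sets are finite. For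
   1 <= t <= k <= v coverings exist (every k-subset repeated l times), so LEAST is a
   genuine minimum. *)
definition covering_number :: "nat \<Rightarrow> nat \<Rightarrow> nat \<Rightarrow> nat \<Rightarrow> nat" where
  "covering_number l v k t =
     (if t = 0 then l
      else LEAST n. \<exists>(V :: nat set) \<B>. covering t v k l V \<B> \<and> size \<B> = n)"

(* Unfolding Suc t times, the innermost factor is (v - t) / (k - t) * l. *)
fun schoenheim :: "nat \<Rightarrow> nat \<Rightarrow> nat \<Rightarrow> nat \<Rightarrow> int" where
  "schoenheim l v k 0 = int l"
| "schoenheim l v k (Suc t) =
     \<lceil>real v / real k * real_of_int (schoenheim l (v - 1) (k - 1) t)\<rceil>"

(* The argument bs is the number b_s. *)
definition CB :: "nat \<Rightarrow> nat \<Rightarrow> nat \<Rightarrow> nat \<Rightarrow> real \<Rightarrow> real \<Rightarrow> real" where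
  "CB v k s bs \<alpha> \<beta> =
     (real bs * (\<alpha> - \<beta>) * real (v choose s) + \<alpha> * real (v choose s)) /
     ((\<alpha> - \<beta>) * real (k choose s) + 1)"

end

theory Submission
  imports Defs
begin

text \<open>
  Take a covering with \<open>n\<close> blocks and let \<open>N\<close> be the 0-1 matrix whose rows are the \<open>s\<close>-subsets of
  the point set, whose columns are the blocks, and which records containment. Any set of linearly
  independent rows has at most \<open>n\<close> elements, so the aim is to find many independent rows, that is,
  a large principal submatrix of \<open>N N\<^sup>T\<close> that is positive definite.

  The entry of \<open>N N\<^sup>T\<close> at \<open>X, Y\<close> is the number of blocks containing \<open>X \<union> Y\<close>. Passing to derived
  coverings, it is at least \<open>b (2 s - i)\<close> for \<open>i = card (X \<inter> Y)\<close>; the difference is the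
  excess. By binomial inversion \<open>b (2 s - i)\<close> is the sum over \<open>j\<close> of \<open>a j\<close> times the number of
  \<open>j\<close>-subsets of \<open>X \<inter> Y\<close>, so the matrix of these lower bounds is a sum of Gram matrices with
  nonnegative coefficients whose term \<open>j = s\<close> is \<open>a s\<close> times the identity
  (\<open>intersection_form_ge\<close>). What could spoil positive definiteness is therefore only the
  off-diagonal excess, a multigraph on the \<open>s\<close>-subsets. Counting flags determines its degrees: a
  set in exactly \<open>b s\<close> blocks has excess degree \<open>d\<close>, and one in \<open>b s + 1\<close> blocks has degree
  \<open>d'\<close> and an extra 1 on the diagonal (\<open>excess_row_sum\<close>). Call the two classes \<open>P\<close> and \<open>Q\<close>.

  As \<open>d < a s\<close>, the rows in \<open>P\<close> satisfy diagonal dominance, with room to spare. The room is used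
  by rescaling the rows of \<open>P\<close> by a factor slightly larger than \<open>\<theta> = d / a s\<close>: after this a set
  \<open>P \<union> S\<close> with \<open>S \<subseteq> Q\<close> is still independent provided that every member of \<open>S\<close> has load less than
  \<open>a s + 1\<close>, where edges inside \<open>S\<close> count fully towards the load and edges to \<open>P\<close> count only
  \<open>\<theta>\<close> (\<open>light_set_positive_definite\<close>). A large \<open>S\<close> of this kind is found by deleting vertices of
  maximum load from \<open>Q\<close> one at a time, with a potential function argument of the kind that gives
  lower bounds on independence numbers in terms of degrees (\<open>light_subset\<close>).

  The resulting bound on \<open>n\<close> still involves how the edges between \<open>P\<close> and \<open>Q\<close> are distributed. The
  alternatives (a), (b) and (c) come from three ways of eliminating this unknown, and each yields
  \<open>n \<ge> \<alpha> |P| + \<beta> |Q|\<close>. Since \<open>\<beta> \<le> \<alpha> / 2\<close> in all cases, the \<open>s\<close>-subsets in more than \<open>b s + 1\<close>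
  blocks can be charged to the count of incidences, and the bound \<open>CB\<close> results (\<open>CB_le\<close>).
\<close>

section \<open>Independent rows from positive definite Gram forms\<close>

text \<open>More unknowns than homogeneous equations leave a nonzero solution, by Gaussian elimination.
  The equations are indexed by a multiset because the blocks of a covering may be repeated.\<close>

lemma nontrivial_relation:
  fixes f :: "'a \<Rightarrow> 'b \<Rightarrow> real"
  assumes "finite R" "size M < card R"
  shows "\<exists>u. (\<exists>x\<in>R. u x \<noteq> 0) \<and> (\<forall>B\<in>#M. (\<Sum>x\<in>R. u x * f x B) = 0)"
  using assms
proof (induction M arbitrary: R f)
  case empty
  then have "R \<noteq> {}" by auto
  then show ?case by (intro exI[of _ "\<lambda>_. 1"]) auto
next
  case (add C M)
  show ?case
  proof (cases "\<exists>p\<in>R. f p C \<noteq> 0")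
    case False
    from add.prems have "size M < card R" by simp
    from add.IH[OF add.prems(1) this, of f] obtain u
      where u: "\<exists>x\<in>R. u x \<noteq> 0" "\<forall>B\<in>#M. (\<Sum>x\<in>R. u x * f x B) = 0" by blast
    have "(\<Sum>x\<in>R. u x * f x C) = 0"
      using False by (intro sum.neutral) auto
    with u show ?thesis by auto
  next
    case True
    then obtain p where p: "p \<in> R" "f p C \<noteq> 0" by blast
    \<comment> \<open>eliminate the unknown \<open>p\<close> with the help of the equation \<open>C\<close>\<close>
    define g where "g x B = f x B - f x C / f p C * f p B" for x B
    have "size M < card (R - {p})" "finite (R - {p})" using add.prems p by auto
    from add.IH[OF this(2) this(1), of g] obtain w
      where w: "\<exists>x\<in>R-{p}. w x \<noteq> 0" "\<forall>B\<in>#M. (\<Sum>x\<in>R-{p}. w x * g x B) = 0" by blast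
    define u where "u x = (if x = p then - (\<Sum>y\<in>R-{p}. w y * (f y C / f p C)) else w x)" for x
    have key: "(\<Sum>x\<in>R. u x * f x B) = (\<Sum>x\<in>R-{p}. w x * g x B)" for B
    proof -
      have "(\<Sum>x\<in>R. u x * f x B) = u p * f p B + (\<Sum>x\<in>R-{p}. u x * f x B)"
        using add.prems p by (simp add: sum.remove)
      also have "(\<Sum>x\<in>R-{p}. u x * f x B) = (\<Sum>x\<in>R-{p}. w x * f x B)"
        by (intro sum.cong) (auto simp: u_def)
      also have "u p * f p B = - (\<Sum>x\<in>R-{p}. w x * (f x C / f p C) * f p B)"
        by (simp add: u_def sum_distrib_right)
      finally show ?thesis
        by (simp add: g_def right_diff_distrib sum_subtractf mult.assoc)
    qed
    have "(\<Sum>x\<in>R. u x * f x C) = 0"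
      unfolding key using p(2) by (simp add: g_def)
    moreover have "\<exists>x\<in>R. u x \<noteq> 0" using w(1) by (auto simp: u_def)
    ultimately show ?thesis using w(2) key by auto
  qed
qed

text \<open>The form is a sum of squares of the left hand sides of the homogeneous system, so it vanishes at
  every solution; when it is positive definite there are no more unknowns than equations.\<close>

lemma card_le_size_if_positive_definite:
  fixes f :: "'a \<Rightarrow> 'b \<Rightarrow> real"
  assumes "finite R"
    and pos: "\<And>u. \<exists>x\<in>R. u x \<noteq> 0 \<Longrightarrow> 0 < (\<Sum>B\<in>#M. (\<Sum>x\<in>R. u x * f x B)\<^sup>2)"
  shows "card R \<le> size M"
proof (rule ccontr)
  assume "\<not> card R \<le> size M"
  then obtain u where u: "\<exists>x\<in>R. u x \<noteq> 0" "\<forall>B\<in>#M. (\<Sum>x\<in>R. u x * f x B) = 0"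
    using nontrivial_relation[OF assms(1), of M f] by auto
  have "image_mset (\<lambda>B. (\<Sum>x\<in>R. u x * f x B)\<^sup>2) M = image_mset (\<lambda>_. 0) M"
    using u(2) by (intro image_mset_cong) auto
  then have "(\<Sum>B\<in>#M. (\<Sum>x\<in>R. u x * f x B)\<^sup>2) = 0" by simp
  with pos[OF u(1)] show False by simp
qed

section \<open>Diagonal dominance after rescaling\<close>

text \<open>The weights \<open>w\<close> amount to a congruence by a diagonal matrix, which turns diagonal dominance into
  a more flexible condition. Instead of rescaling, the off-diagonal terms are estimated by the
  correspondingly weighted arithmetic-geometric mean inequality.\<close>

lemma scaled_diagonal_dominance:
  fixes g w u :: "'a \<Rightarrow> real" and E :: "'a \<Rightarrow> 'a \<Rightarrow> nat"
  assumes "finite R" and sym: "\<And>x y. E x y = E y x"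
    and w: "\<And>x. x \<in> R \<Longrightarrow> 0 < w x"
    and dom: "\<And>x. x \<in> R \<Longrightarrow> (\<Sum>y\<in>R-{x}. E x y * w y) < g x * w x"
    and u: "\<exists>x\<in>R. u x \<noteq> 0"
  shows "0 < (\<Sum>x\<in>R. g x * (u x)\<^sup>2) + (\<Sum>x\<in>R. \<Sum>y\<in>R-{x}. E x y * (u x * u y))"
proof -
  define F where "F x y = (if x = y then 0 else real (E x y))" for x y
  have F: "(\<Sum>y\<in>R-{x}. E x y * h y) = (\<Sum>y\<in>R. F x y * h y)" if "x \<in> R" for x and h :: "'a \<Rightarrow> real"
  proof -
    have "(\<Sum>y\<in>R. F x y * h y) = F x x * h x + (\<Sum>y\<in>R-{x}. F x y * h y)"
      using that assms(1) by (simp add: sum.remove)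
    also have "\<dots> = 0 + (\<Sum>y\<in>R-{x}. E x y * h y)"
      by (intro arg_cong2[where f = "(+)"] sum.cong) (auto simp: F_def)
    finally show ?thesis by simp
  qed
  have Fsym: "F x y = F y x" for x y using sym by (simp add: F_def)
  have F0: "0 \<le> F x y" for x y by (simp add: F_def)
  let ?q = "\<lambda>x y. F x y * (w y / w x * (u x)\<^sup>2)"
  have amgm: "- (?q x y + ?q y x) \<le> 2 * (F x y * (u x * u y))" if "x \<in> R" "y \<in> R" for x y
  proof -
    have wx: "0 < w x" "0 < w y" using w that by auto
    have "w y / w x * (u x)\<^sup>2 + w x / w y * (u y)\<^sup>2 + 2 * (u x * u y)
        = (w y * u x + w x * u y)\<^sup>2 / (w x * w y)"
      using wx by (simp add: field_simps power2_eq_square)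
    also have "\<dots> \<ge> 0" using wx by simp
    finally have "0 \<le> F x y * (w y / w x * (u x)\<^sup>2 + w x / w y * (u y)\<^sup>2 + 2 * (u x * u y))"
      using F0 by simp
    then show ?thesis by (simp add: Fsym[of y x] algebra_simps)
  qed
  have "- (2 * (\<Sum>x\<in>R. \<Sum>y\<in>R. ?q x y)) = (\<Sum>x\<in>R. \<Sum>y\<in>R. - (?q x y + ?q y x))"
    using sum.swap[of ?q R R] by (simp only: sum.distrib sum_negf minus_add_distrib)
  also have "\<dots> \<le> (\<Sum>x\<in>R. \<Sum>y\<in>R. 2 * (F x y * (u x * u y)))"
    by (intro sum_mono amgm)
  also have "\<dots> = 2 * (\<Sum>x\<in>R. \<Sum>y\<in>R. F x y * (u x * u y))"
    by (simp add: sum_distrib_left)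
  finally have low: "- (\<Sum>x\<in>R. \<Sum>y\<in>R. ?q x y) \<le> (\<Sum>x\<in>R. \<Sum>y\<in>R. F x y * (u x * u y))" by simp
  have row: "(\<Sum>y\<in>R. ?q x y) = (\<Sum>y\<in>R-{x}. E x y * w y) / w x * (u x)\<^sup>2" if "x \<in> R" for x
    unfolding F[OF that] by (simp add: sum_distrib_right sum_divide_distrib mult.assoc)
  have "(\<Sum>x\<in>R. \<Sum>y\<in>R. ?q x y) < (\<Sum>x\<in>R. g x * (u x)\<^sup>2)"
  proof (rule sum_strict_mono_ex1)
    have c: "(\<Sum>y\<in>R-{x}. E x y * w y) / w x < g x" if "x \<in> R" for x
      using dom[OF that] w[OF that] by (simp add: field_simps)
    show "\<forall>x\<in>R. (\<Sum>y\<in>R. ?q x y) \<le> g x * (u x)\<^sup>2"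
      by (intro ballI, subst row) (assumption, intro mult_right_mono less_imp_le[OF c] zero_le_power2)
    from u obtain x where x: "x \<in> R" "u x \<noteq> 0" by blast
    then have "(\<Sum>y\<in>R. ?q x y) < g x * (u x)\<^sup>2"
      by (subst row) (assumption, intro mult_strict_right_mono c, auto)
    with x show "\<exists>x\<in>R. (\<Sum>y\<in>R. ?q x y) < g x * (u x)\<^sup>2" by blast
  qed (use assms(1) in auto)
  with low show ?thesis by (simp add: F)
qed

text \<open>Edges to \<open>P\<close> count with weight \<open>\<theta>\<close> because this is what they cost a vertex of \<open>Q\<close> once the rows
  in \<open>P\<close> have been rescaled by \<open>\<theta>\<close>.\<close>

definition load :: "real \<Rightarrow> ('a \<Rightarrow> 'a \<Rightarrow> nat) \<Rightarrow> 'a set \<Rightarrow> 'a set \<Rightarrow> 'a \<Rightarrow> real" where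
  "load \<theta> E P Q y = real (\<Sum>z\<in>Q-{y}. E y z) + \<theta> * real (\<Sum>x\<in>P. E y x)"

text \<open>Rescaling \<open>P\<close> by exactly \<open>d / a\<close> may leave only weak dominance on \<open>P\<close>. The load condition is
  strict and \<open>S\<close> is finite, so a slightly larger factor \<open>\<tau>\<close> preserves it and makes dominance
  strict on \<open>P\<close> as well. This also covers \<open>d = 0\<close>, where \<open>d / a\<close> is not an admissible factor.\<close>

lemma light_set_positive_definite:
  fixes a :: real and d :: nat and u :: "'a \<Rightarrow> real" and E :: "'a \<Rightarrow> 'a \<Rightarrow> nat"
  assumes "finite P" "finite S" "P \<inter> S = {}" and sym: "\<And>x y. E x y = E y x"
    and da: "real d < a"
    and P: "\<And>x. x \<in> P \<Longrightarrow> (\<Sum>y\<in>P\<union>S-{x}. E x y) \<le> d"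
    and S: "\<And>y. y \<in> S \<Longrightarrow> load (d / a) E P S y < a + 1"
    and u: "\<exists>x\<in>P\<union>S. u x \<noteq> 0"
  shows "0 < (\<Sum>x\<in>P\<union>S. (if x \<in> P then a else a + 1) * (u x)\<^sup>2)
      + (\<Sum>x\<in>P\<union>S. \<Sum>y\<in>P\<union>S-{x}. E x y * (u x * u y))"
proof -
  have a: "0 < a" using da by simp
  have "eventually (\<lambda>\<tau>. \<forall>y\<in>S. load \<tau> E P S y < a + 1) (at_right (d / a))"
  proof (intro eventually_ball_finite ballI)
    fix y assume "y \<in> S"
    have "((\<lambda>\<tau>. load \<tau> E P S y) \<longlongrightarrow> load (d / a) E P S y) (at_right (d / a))"
      unfolding load_def by (intro tendsto_intros)
    then show "eventually (\<lambda>\<tau>. load \<tau> E P S y < a + 1) (at_right (d / a))"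
      using S[OF \<open>y \<in> S\<close>] by (rule order_tendstoD)
  qed fact
  moreover have "eventually (\<lambda>\<tau>. \<tau> \<in> {d / a<..<1}) (at_right (d / a))"
    using da a by (intro eventually_at_right_real) (simp add: field_simps)
  ultimately have "eventually (\<lambda>\<tau>. (\<forall>y\<in>S. load \<tau> E P S y < a + 1) \<and> \<tau> \<in> {d / a<..<1})
      (at_right (d / a))" by (rule eventually_conj)
  then obtain \<tau> where \<tau>: "\<forall>y\<in>S. load \<tau> E P S y < a + 1" "d / a < \<tau>" "\<tau> < 1"
    using eventually_happens' trivial_limit_at_right_real by fastforce
  have \<tau>0: "0 < \<tau>" using \<tau>(2) a by (meson divide_nonneg_pos le_less_trans of_nat_0_le_iff)
  define w where "w x = (if x \<in> P then \<tau> else 1)" for x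
  show ?thesis
  proof (rule scaled_diagonal_dominance[where w = w, OF _ sym])
    show "finite (P \<union> S)" using assms by simp
    show "0 < w x" for x using \<tau>0 by (simp add: w_def)
    show "\<exists>x\<in>P\<union>S. u x \<noteq> 0" by (fact u)
    show "(\<Sum>y\<in>P\<union>S-{x}. E x y * w y) < (if x \<in> P then a else a + 1) * w x" if x: "x \<in> P \<union> S" for x
    proof (cases "x \<in> P")
      case True
      \<comment> \<open>\<open>\<tau> < 1\<close> lets all neighbours of a vertex in \<open>P\<close> be charged with weight 1\<close>
      have "(\<Sum>y\<in>P\<union>S-{x}. E x y * w y) \<le> (\<Sum>y\<in>P\<union>S-{x}. real (E x y) * 1)"
        using \<tau> by (intro sum_mono mult_left_mono) (auto simp: w_def)
      also have "\<dots> \<le> d" using P[OF True] by (simp flip: of_nat_sum)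
      also have "\<dots> < a * \<tau>" using \<tau>(2) a by (simp add: field_simps)
      finally show ?thesis using True by (simp add: w_def)
    next
      case False
      then have xS: "x \<in> S" using x by simp
      have "P \<union> S - {x} = P \<union> (S - {x})" using False by auto
      then have "(\<Sum>y\<in>P\<union>S-{x}. E x y * w y) = (\<Sum>y\<in>P. E x y * w y) + (\<Sum>y\<in>S-{x}. E x y * w y)"
        using assms(1-3) by (simp only:) (rule sum.union_disjoint, auto)
      also have "(\<Sum>y\<in>P. E x y * w y) = \<tau> * (\<Sum>y\<in>P. E x y)"
        by (simp add: w_def sum_distrib_left mult.commute)
      also have "(\<Sum>y\<in>S-{x}. E x y * w y) = (\<Sum>y\<in>S-{x}. real (E x y))"
        using assms(3) by (intro sum.cong) (auto simp: w_def)
      finally have "(\<Sum>y\<in>P\<union>S-{x}. E x y * w y) = load \<tau> E P S x"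
        by (simp add: load_def)
      then show ?thesis using \<tau>(1) xS False by (simp only: w_def) simp
    qed
  qed
qed

section \<open>Deleting heavy vertices\<close>

text \<open>The potential of a vertex of load \<open>D\<close>, an estimate of its share in the set that survives the
  deletions. On the right branch the credit of a deleted vertex is covered by what its neighbours
  gain; the left branch is the chord of the right one over \<open>[m - 1, m]\<close>, prolonged until it
  reaches 1 at \<open>D = 0\<close>.\<close>

definition credit :: "real \<Rightarrow> real \<Rightarrow> real" where
  "credit m D = (if D \<le> m then 1 - D / (2 * m) else (m + 1) / (2 * (D + 1)))"

lemma credit_ge: "0 < m \<Longrightarrow> m \<le> D \<Longrightarrow> credit m D = (m + 1) / (2 * (D + 1))"
  by (cases "D = m") (auto simp: credit_def field_simps)

text \<open>By convexity the gain from a unit decrease of the load is smallest at the largest possible load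
  \<open>M\<close>, where the difference of the hyperbola is the stated fraction.\<close>

lemma credit_decrement:
  assumes "0 < m" "m \<le> M" "D \<le> M"
  shows "credit m D + (m + 1) / (2 * M * (M + 1)) \<le> credit m (D - 1)"
proof -
  have le: "(m + 1) / (2 * M * (M + 1)) \<le> (m + 1) / (2 * D * (D + 1))" if "m \<le> D"
    using assms that by (intro divide_left_mono mult_mono mult_pos_pos) auto
  have le': "(m + 1) / (2 * D * (D + 1)) = (m + 1) / (2 * D) - (m + 1) / (2 * (D + 1))"
    if "m \<le> D" using assms that by (simp add: divide_simps) (simp add: algebra_simps)
  consider "D \<le> m" | "m < D" "D - 1 \<le> m" | "m < D - 1" by linarith
  then show ?thesis
  proof cases
    case 1
    have "(m + 1) / (2 * M * (M + 1)) \<le> (m + 1) / (2 * m * (m + 1))"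
      using assms by (intro divide_left_mono mult_mono mult_pos_pos) auto
    also have "\<dots> = 1 / (2 * m)" using assms by (simp add: divide_simps)
    finally have "(m + 1) / (2 * M * (M + 1)) \<le> 1 / (2 * m)" .
    moreover have "1 - (D - 1) / (2 * m) = 1 - D / (2 * m) + 1 / (2 * m)"
      by (simp add: diff_divide_distrib)
    ultimately show ?thesis using 1 by (simp add: credit_def)
  next
    case 2
    \<comment> \<open>on \<open>[m - 1, m]\<close> the chord lies above the hyperbola\<close>
    have "0 \<le> (D - m) * (m - (D - 1))" using 2 by simp
    then have "(m + 1) / (2 * D) \<le> 1 - (D - 1) / (2 * m)"
      using 2 assms by (simp add: field_simps)
    then show ?thesis using 2 le le' by (simp add: credit_def)
  next
    case 3
    then show ?thesis using le le' by (simp add: credit_def)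
  qed
qed

lemma credit_decrease:
  assumes "0 < m" "m \<le> M" "D \<le> M"
  shows "credit m D + real \<mu> * ((m + 1) / (2 * M * (M + 1))) \<le> credit m (D - real \<mu>)"
proof (induction \<mu>)
  case (Suc \<mu>)
  define \<delta> where "\<delta> = (m + 1) / (2 * M * (M + 1))"
  have "credit m D + real (Suc \<mu>) * \<delta> = (credit m D + real \<mu> * \<delta>) + \<delta>"
    by (simp add: distrib_right)
  also have "\<dots> \<le> credit m (D - real \<mu>) + \<delta>"
    using Suc unfolding \<delta>_def by (intro add_right_mono)
  also have "\<dots> \<le> credit m (D - real \<mu> - 1)"
    unfolding \<delta>_def using assms by (intro credit_decrement) auto
  also have "D - real \<mu> - 1 = D - real (Suc \<mu>)" by simp
  finally show ?case unfolding \<delta>_def .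
qed simp

text \<open>Delete a vertex \<open>y\<close> of maximum load \<open>M\<close> as long as \<open>M \<ge> m\<close>. Each edge from \<open>y\<close> to another
  vertex of \<open>Q\<close> raises the credits by at least \<open>\<delta> = (m + 1) / (2 M (M + 1))\<close>, and each edge to
  \<open>P\<close> removes a penalty \<open>\<theta> / (2 m) \<ge> \<theta> \<delta>\<close>. Together this gains at least \<open>M \<delta>\<close>, which is
  precisely the credit lost with \<open>y\<close>. When no heavy vertex remains, all credits are at most 1.\<close>

lemma light_subset:
  fixes E :: "'a \<Rightarrow> 'a \<Rightarrow> nat"
  assumes "finite Q" "0 < m" "0 \<le> \<theta>" and sym: "\<And>x y. E x y = E y x"
  shows "\<exists>S\<subseteq>Q. (\<forall>y\<in>S. load \<theta> E P S y < m) \<and>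
    (\<Sum>y\<in>Q. credit m (load \<theta> E P Q y)) - \<theta> / (2 * m) * real (\<Sum>y\<in>Q. \<Sum>x\<in>P. E y x) \<le> real (card S)"
  using assms(1)
proof (induction Q rule: finite_psubset_induct)
  case (psubset Q)
  let ?L = "load \<theta> E P"
  show ?case
  proof (cases "\<forall>y\<in>Q. ?L Q y < m")
    case True
    have "credit m (?L Q y) \<le> 1" if "y \<in> Q" for y
    proof -
      have "0 \<le> ?L Q y" unfolding load_def using assms(3)
        by (intro add_nonneg_nonneg mult_nonneg_nonneg of_nat_0_le_iff)
      then show ?thesis using True that assms(2) by (auto simp: credit_def)
    qed
    then have "(\<Sum>y\<in>Q. credit m (?L Q y)) \<le> (\<Sum>y\<in>Q. 1)" by (intro sum_mono) auto
    moreover have "0 \<le> \<theta> / (2 * m) * real (\<Sum>y\<in>Q. \<Sum>x\<in>P. E y x)"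
      using assms(2,3) by (intro mult_nonneg_nonneg divide_nonneg_pos of_nat_0_le_iff) auto
    ultimately show ?thesis using True by (intro exI[of _ Q]) auto
  next
    case False
    define M where "M = Max (?L Q ` Q)"
    have "Q \<noteq> {}" using False by auto
    then have "M \<in> ?L Q ` Q" unfolding M_def using psubset.hyps by (intro Max_in) auto
    then obtain y where y: "y \<in> Q" "?L Q y = M" by auto
    have M: "?L Q z \<le> M" if "z \<in> Q" for z
      unfolding M_def using that psubset.hyps by (intro Max_ge) auto
    have mM: "m \<le> M" using False M by fastforce
    define Q' where "Q' = Q - {y}"
    define \<delta> where "\<delta> = (m + 1) / (2 * M * (M + 1))"
    have fin: "finite Q" "finite Q'" using psubset.hyps by (auto simp: Q'_def)
    have "Q' \<subset> Q" using y by (auto simp: Q'_def)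
    from psubset.IH[OF this] obtain S where S: "S \<subseteq> Q'" "\<forall>z\<in>S. ?L S z < m"
      "(\<Sum>z\<in>Q'. credit m (?L Q' z)) - \<theta> / (2 * m) * real (\<Sum>z\<in>Q'. \<Sum>x\<in>P. E z x) \<le> real (card S)"
      by blast
    define e1 where "e1 = real (\<Sum>z\<in>Q'. E y z)"
    define e0 where "e0 = real (\<Sum>x\<in>P. E y x)"
    have Me: "M = e1 + \<theta> * e0" using y by (simp add: load_def e1_def e0_def Q'_def)
    have step: "credit m (?L Q z) + real (E y z) * \<delta> \<le> credit m (?L Q' z)" if "z \<in> Q'" for z
    proof -
      have "Q - {z} = insert y (Q' - {z})" "y \<notin> Q' - {z}" using that y by (auto simp: Q'_def)
      then have "?L Q z = ?L Q' z + real (E y z)"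
        using fin by (simp add: load_def sym[of z y])
      then have "?L Q' z = ?L Q z - real (E y z)" by simp
      then show ?thesis
        unfolding \<delta>_def using credit_decrease[OF assms(2) mM M[of z], of "E y z"] that
        by (simp add: Q'_def)
    qed
    have "(\<Sum>z\<in>Q'. credit m (?L Q z) + real (E y z) * \<delta>) \<le> (\<Sum>z\<in>Q'. credit m (?L Q' z))"
      by (intro sum_mono step)
    then have s1: "(\<Sum>z\<in>Q'. credit m (?L Q z)) + e1 * \<delta> \<le> (\<Sum>z\<in>Q'. credit m (?L Q' z))"
      by (simp add: sum.distrib e1_def sum_distrib_right)
    have s2: "(\<Sum>z\<in>Q. credit m (?L Q z)) = credit m M + (\<Sum>z\<in>Q'. credit m (?L Q z))"
      using y fin by (simp add: Q'_def sum.remove)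
    have s3: "real (\<Sum>z\<in>Q. \<Sum>x\<in>P. E z x) = e0 + real (\<Sum>z\<in>Q'. \<Sum>x\<in>P. E z x)"
      using y fin by (simp add: Q'_def e0_def sum.remove)
    have "\<delta> \<le> (m + 1) / (2 * m * (m + 1))"
      unfolding \<delta>_def using assms mM by (intro divide_left_mono mult_mono mult_pos_pos) auto
    also have "\<dots> = 1 / (2 * m)" using assms by (simp add: divide_simps)
    finally have "\<theta> * e0 * \<delta> \<le> \<theta> * e0 * (1 / (2 * m))"
      using assms(3) by (intro mult_left_mono mult_nonneg_nonneg) (auto simp: e0_def sum_nonneg)
    moreover have "credit m M = M * \<delta>"
      using credit_ge[OF assms(2) mM] mM assms(2) by (simp add: \<delta>_def)
    ultimately have "credit m M \<le> e1 * \<delta> + \<theta> / (2 * m) * e0"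
      by (simp add: Me algebra_simps)
    with s1 s2 s3 S(3) have "(\<Sum>z\<in>Q. credit m (?L Q z))
        - \<theta> / (2 * m) * real (\<Sum>z\<in>Q. \<Sum>x\<in>P. E z x) \<le> real (card S)"
      by (simp add: distrib_left)
    with S show ?thesis by (intro exI[of _ S]) (auto simp: Q'_def)
  qed
qed

section \<open>Linear bounds from the excess multigraph\<close>

lemma credit_antimono:
  assumes "0 < m" "D \<le> D'"
  shows "credit m D' \<le> credit m D"
proof -
  consider "D' \<le> m" | "D \<le> m" "m < D'" | "m < D" using assms by linarith
  then show ?thesis
  proof cases
    case 1
    then show ?thesis using assms by (simp add: credit_def divide_right_mono)
  next
    case 2
    have "(m + 1) / (2 * (D' + 1)) \<le> (m + 1) / (2 * (m + 1))"
      using 2 assms by (intro divide_left_mono mult_pos_pos) auto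
    also have "\<dots> = 1 - m / (2 * m)" using assms by simp
    also have "\<dots> \<le> 1 - D / (2 * m)"
      using 2 assms by (intro diff_left_mono divide_right_mono) auto
    finally show ?thesis using 2 by (simp add: credit_def)
  next
    case 3
    then show ?thesis using assms by (auto simp: credit_def intro!: divide_left_mono mult_pos_pos)
  qed
qed

text \<open>The credit is convex, so it lies above the line that extends its left branch.\<close>

lemma credit_ge_linear:
  assumes "0 < m"
  shows "1 - D / (2 * m) \<le> credit m D"
proof (cases "D \<le> m")
  case False
  have "0 \<le> (D - m) * (D - m) + (D - m)" using False assms by simp
  then have "(2 * m - D) * (D + 1) \<le> m * (m + 1)"
    by (simp add: algebra_simps power2_eq_square)
  then have "(2 * m - D) / (2 * m) \<le> (m + 1) / (2 * (D + 1))"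
    using False assms by (simp add: field_simps)
  moreover have "(2 * m - D) / (2 * m) = 1 - D / (2 * m)"
    using assms by (simp add: diff_divide_distrib)
  ultimately show ?thesis using False by (simp add: credit_def)
qed (simp add: credit_def)

text \<open>The line of slope \<open>- q / 2\<close> tangent to the hyperbola \<open>(m + 1) / (2 (D + 1))\<close>; the bound on \<open>q\<close>
  says that it is no steeper than the left branch of the credit and hence stays below it.\<close>

lemma credit_ge_tangent:
  assumes "0 < m" "0 \<le> q" "q * m \<le> 1"
  shows "sqrt (q * (m + 1)) - q / 2 * (D + 1) \<le> credit m D"
proof -
  have hyp: "sqrt (q * (m + 1)) - q / 2 * (D + 1) \<le> (m + 1) / (2 * (D + 1))" if "m \<le> D" for D
  proof -
    have D: "0 < D + 1" using that assms by simp
    \<comment> \<open>the tangent line in the form of the arithmetic-geometric mean inequality\<close>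
    have "sqrt ((m + 1) / (D + 1) * (q * (D + 1))) \<le> ((m + 1) / (D + 1) + q * (D + 1)) / 2"
      using D assms by (intro arith_geo_mean_sqrt) auto
    moreover have "(m + 1) / (D + 1) * (q * (D + 1)) = q * (m + 1)" using D by simp
    moreover have "((m + 1) / (D + 1) + q * (D + 1)) / 2 = (m + 1) / (2 * (D + 1)) + q / 2 * (D + 1)"
      by (simp add: add_divide_distrib mult.commute)
    ultimately show ?thesis by (simp only: diff_le_eq)
  qed
  show ?thesis
  proof (cases "D \<le> m")
    case False
    then show ?thesis using hyp[of D] by (simp add: credit_def)
  next
    case True
    \<comment> \<open>compare at \<open>D = m\<close> and move left along the flatter line\<close>
    have "sqrt (q * (m + 1)) - q / 2 * (m + 1) \<le> 1 / 2"
    proof -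
      have "(m + 1) / (2 * (m + 1)) = 1 / 2" using assms by simp
      with hyp[of m] show ?thesis by (simp only: order_refl)
    qed
    moreover have "q / 2 * (m - D) \<le> 1 / (2 * m) * (m - D)"
      using assms True by (intro mult_right_mono) (auto simp: field_simps)
    moreover have "1 / (2 * m) * (m - D) = 1 / 2 - D / (2 * m)"
      using assms by (simp add: field_simps)
    moreover have "q / 2 * (m + 1) - q / 2 * (D + 1) = q / 2 * (m - D)"
      by (simp add: field_simps)
    moreover have "credit m D = 1 - D / (2 * m)" using True by (simp add: credit_def)
    ultimately show ?thesis by linarith
  qed
qed

text \<open>The vertices in \<open>P\<close> and \<open>Q\<close> stand for \<open>s\<close>-subsets in \<open>b s\<close> and \<open>b s + 1\<close> blocks, \<open>E\<close> for the
  excess, and \<open>n\<close> for the number of blocks.\<close>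

locale excess_graph =
  fixes P Q :: "'a set" and E :: "'a \<Rightarrow> 'a \<Rightarrow> nat" and a :: real and d d' n :: nat
  assumes finite_Q: "finite Q"
    and sym: "E x y = E y x"
    and d_less: "d < a" and d'_ge: "a + 1 + d \<le> d'"
    and P_row: "x \<in> P \<Longrightarrow> (\<Sum>y\<in>Q. E x y) \<le> d"
    and Q_row: "y \<in> Q \<Longrightarrow> (\<Sum>z\<in>Q-{y}. E y z) + (\<Sum>x\<in>P. E y x) \<le> d'"
    and light_bound: "\<lbrakk>S \<subseteq> Q; \<And>y. y \<in> S \<Longrightarrow> load (d / a) E P S y < a + 1\<rbrakk> \<Longrightarrow> card P + card S \<le> n"
begin

abbreviation (input) "\<theta> \<equiv> d / a"

definition edges :: real where
  "edges = real (\<Sum>y\<in>Q. \<Sum>x\<in>P. E y x)"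

lemma a_pos: "0 < a" using d_less by simp

lemma theta: "0 \<le> \<theta>" "\<theta> < 1" using d_less a_pos by simp_all

text \<open>The number of edges between \<open>P\<close> and \<open>Q\<close> is the unknown that the three final bounds have to
  eliminate; it is limited by the degrees on either side.\<close>

lemma edges_le_P: "edges \<le> d * card P"
proof -
  have "(\<Sum>y\<in>Q. \<Sum>x\<in>P. E y x) = (\<Sum>x\<in>P. \<Sum>y\<in>Q. E x y)"
    by (subst sum.swap) (simp add: sym)
  also have "\<dots> \<le> (\<Sum>x\<in>P. d)" by (intro sum_mono P_row)
  finally have "(\<Sum>y\<in>Q. \<Sum>x\<in>P. E y x) \<le> d * card P" by (simp add: mult.commute)
  then show ?thesis unfolding edges_def by (rule of_nat_mono)
qed

lemma edges_le_Q: "edges \<le> d' * card Q"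
proof -
  have "(\<Sum>y\<in>Q. \<Sum>x\<in>P. E y x) \<le> (\<Sum>y\<in>Q. d')"
    using Q_row by (intro sum_mono) fastforce
  then have "(\<Sum>y\<in>Q. \<Sum>x\<in>P. E y x) \<le> d' * card Q" by (simp add: mult.commute)
  then show ?thesis unfolding edges_def by (rule of_nat_mono)
qed

text \<open>Edges to \<open>P\<close> are cheaper than edges inside \<open>Q\<close>, so a vertex with many of them has a smaller
  load than its degree suggests. This gain works against the penalty of \<open>light_subset\<close> for these
  edges.\<close>

lemma load_le:
  assumes "y \<in> Q"
  shows "load \<theta> E P Q y \<le> d' - (1 - \<theta>) * (\<Sum>x\<in>P. E y x)"
  using Q_row[OF assms] by (simp add: load_def algebra_simps flip: of_nat_add of_nat_sum)

lemma credit_bound: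
  "card P - \<theta> / (2 * (a + 1)) * edges
     + (\<Sum>y\<in>Q. credit (a + 1) (d' - (1 - \<theta>) * (\<Sum>x\<in>P. E y x))) \<le> n"
proof -
  have m: "0 < a + 1" using a_pos by simp
  from light_subset[of Q "a + 1" \<theta> E P, OF finite_Q m theta(1) sym, folded edges_def]
  obtain S
    where S: "S \<subseteq> Q" "\<forall>y\<in>S. load \<theta> E P S y < a + 1"
      "(\<Sum>y\<in>Q. credit (a + 1) (load \<theta> E P Q y)) - \<theta> / (2 * (a + 1)) * edges \<le> card S"
    by (elim exE conjE) (rule that)
  have "(\<Sum>y\<in>Q. credit (a + 1) (d' - (1 - \<theta>) * (\<Sum>x\<in>P. E y x)))
      \<le> (\<Sum>y\<in>Q. credit (a + 1) (load \<theta> E P Q y))"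
    by (intro sum_mono credit_antimono m load_le)
  moreover have "card P + card S \<le> n" using S by (intro light_bound) auto
  then have "real (card P) + real (card S) \<le> real n" by linarith
  ultimately show ?thesis using S(3) by linarith
qed

text \<open>A linear lower bound for the credit turns the sum over \<open>Q\<close> into an expression in which the
  distribution of the edges to \<open>P\<close> over \<open>Q\<close> no longer matters, only their total number.\<close>

lemma linear_bound:
  fixes c \<sigma> :: real
  assumes lin: "\<And>D. c - \<sigma> * D \<le> credit (a + 1) D"
  shows "card P + (\<sigma> * (1 - \<theta>) - \<theta> / (2 * (a + 1))) * edges + (c - \<sigma> * d') * card Q \<le> n"
proof -
  let ?e = "\<lambda>y. real (\<Sum>x\<in>P. E y x)"
  have "(c - \<sigma> * d') * card Q + \<sigma> * (1 - \<theta>) * edges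
      = (\<Sum>y\<in>Q. c - \<sigma> * (d' - (1 - \<theta>) * ?e y))"
    unfolding edges_def of_nat_sum
    by (simp add: algebra_simps sum.distrib sum_subtractf sum_distrib_left)
  also have "\<dots> \<le> (\<Sum>y\<in>Q. credit (a + 1) (d' - (1 - \<theta>) * ?e y))"
    by (intro sum_mono lin)
  finally show ?thesis using credit_bound by (simp add: left_diff_distrib)
qed

text \<open>Here the discount on edges to \<open>P\<close> is given away: every vertex of \<open>Q\<close> is treated as having load
  \<open>d'\<close>, and every vertex of \<open>P\<close> as having all its \<open>d\<close> edges penalised.\<close>

lemma bound_a: "(1 - d\<^sup>2 / (2 * a * (a + 1))) * card P + (a + 2) / (2 * (d' + 1)) * card Q \<le> n"
proof -
  have "\<theta> / (2 * (a + 1)) * edges \<le> \<theta> / (2 * (a + 1)) * (d * card P)"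
    using theta a_pos by (intro mult_left_mono edges_le_P divide_nonneg_nonneg) auto
  also have "\<dots> = d\<^sup>2 / (2 * a * (a + 1)) * card P"
    by (simp add: power2_eq_square mult_ac)
  finally have 1: "\<theta> / (2 * (a + 1)) * edges \<le> d\<^sup>2 / (2 * a * (a + 1)) * card P" .
  have "(\<Sum>y\<in>Q. (a + 2) / (2 * (d' + 1)))
      \<le> (\<Sum>y\<in>Q. credit (a + 1) (d' - (1 - \<theta>) * (\<Sum>x\<in>P. E y x)))"
  proof (intro sum_mono)
    fix y assume "y \<in> Q"
    have "(a + 2) / (2 * (d' + 1)) = credit (a + 1) d'"
      using credit_ge[of "a + 1" d'] a_pos d'_ge by (simp add: add.commute)
    also have "\<dots> \<le> credit (a + 1) (d' - (1 - \<theta>) * (\<Sum>x\<in>P. E y x))"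
      using theta a_pos by (intro credit_antimono) (auto intro!: mult_nonneg_nonneg sum_nonneg)
    finally show "(a + 2) / (2 * (d' + 1)) \<le> credit (a + 1) (d' - (1 - \<theta>) * (\<Sum>x\<in>P. E y x))" .
  qed
  then have "(a + 2) / (2 * (d' + 1)) * card Q
      \<le> (\<Sum>y\<in>Q. credit (a + 1) (d' - (1 - \<theta>) * (\<Sum>x\<in>P. E y x)))"
    by (simp only: sum_constant mult.commute)
  with 1 credit_bound show ?thesis unfolding left_diff_distrib mult_1 by linarith
qed

text \<open>With the slope \<open>1 / (2 (a + 1))\<close> of the left branch of the credit, an edge between \<open>P\<close> and \<open>Q\<close>
  contributes \<open>(1 - 2 \<theta>) / (2 (a + 1))\<close>. For \<open>\<theta> \<ge> 1 / 2\<close> this is a loss, which is charged to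
  the \<open>d'\<close> possible edges at each vertex of \<open>Q\<close>.\<close>

lemma bound_b:
  assumes "a / 2 \<le> d"
  shows "card P + (1 - d * d' / (a * (a + 1))) * card Q \<le> n"
proof -
  let ?m = "2 * (a + 1)"
  have m: "0 < ?m" using a_pos by simp
  have "1 / 2 \<le> \<theta>" using assms a_pos by (simp add: field_simps)
  then have "1 - 2 * \<theta> \<le> 0" by linarith
  then have "1 / ?m * (1 - 2 * \<theta>) \<le> 0" using m by (intro mult_nonneg_nonpos) auto
  from mult_left_mono_neg[OF edges_le_Q this]
  have "1 / ?m * (1 - 2 * \<theta>) * (d' * card Q) \<le> 1 / ?m * (1 - 2 * \<theta>) * edges" .
  moreover have "card P + (1 / ?m * (1 - \<theta>) - \<theta> / ?m) * edges + (1 - 1 / ?m * d') * card Q \<le> n"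
    using m credit_ge_linear[of "a + 1"] a_pos by (intro linear_bound) auto
  moreover have "1 / ?m * (1 - \<theta>) - \<theta> / ?m = 1 / ?m * (1 - 2 * \<theta>)"
    by (simp add: diff_divide_distrib)
  moreover have "1 / ?m * (1 - 2 * \<theta>) * (d' * card Q) + (1 - 1 / ?m * d') * card Q
      = (1 - \<theta> * d' / (a + 1)) * card Q"
    using m by (simp add: divide_simps) (simp add: algebra_simps)
  ultimately show ?thesis by (simp add: mult.assoc)
qed

text \<open>The slope is chosen such that the discount and the penalty of an edge between \<open>P\<close> and \<open>Q\<close> cancel
  exactly. For \<open>\<theta> < 1 / 2\<close> this slope is flatter than the left branch of the credit, so a tangent
  of the hyperbola has it.\<close>

lemma bound_c:
  assumes "d < a / 2"
  shows "card P + (sqrt (d * (a + 2) / ((a + 1) * (a - d)))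
      - d * (d' + 1) / (2 * (a + 1) * (a - d))) * card Q \<le> n"
proof -
  define q where "q = d / ((a + 1) * (a - d))"
  have pos: "0 < a - d" "0 < a + 1" using d_less a_pos by auto
  have q: "0 \<le> q" using pos by (simp add: q_def)
  have "q * (a + 1) = d / (a - d)" using pos by (simp add: q_def)
  also have "\<dots> \<le> 1" using pos assms by simp
  finally have q1: "q * (a + 1) \<le> 1" .
  have slope: "q / 2 * (1 - \<theta>) - \<theta> / (2 * (a + 1)) = 0"
    using pos a_pos by (simp add: q_def divide_simps)
  let ?c = "sqrt (q * (a + 1 + 1)) - q / 2"
  have "card P + (q / 2 * (1 - \<theta>) - \<theta> / (2 * (a + 1))) * edges + (?c - q / 2 * d') * card Q \<le> n"
  proof (intro linear_bound)
    show "?c - q / 2 * D \<le> credit (a + 1) D" for D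
      using credit_ge_tangent[OF pos(2) q q1, of D] by (simp add: distrib_left)
  qed
  moreover have "?c - q / 2 * d' = sqrt (q * (a + 2)) - q / 2 * (d' + 1)"
    by (simp add: distrib_left add.commute)
  moreover have "q * (a + 2) = d * (a + 2) / ((a + 1) * (a - d))" by (simp add: q_def)
  moreover have "q / 2 * (d' + 1) = d * (d' + 1) / (2 * (a + 1) * (a - d))"
    by (simp add: q_def mult.assoc) (simp add: algebra_simps)
  ultimately show ?thesis unfolding slope by (simp only: mult_zero_left add_0_right)
qed

end

section \<open>Subsets, intersections and incidences\<close>

text \<open>Binomial inversion, from the vanishing of the alternating row sums of the binomial
  coefficients.\<close>

lemma inverse_binomial:
  fixes a f :: "nat \<Rightarrow> int"
  assumes a: "\<And>j. j \<le> n \<Longrightarrow> a j = (\<Sum>l = 0..j. (- 1) ^ (l + j) * int (j choose l) * f l)"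
  shows "f n = (\<Sum>j\<le>n. int (n choose j) * a j)"
proof -
  let ?h = "\<lambda>j l. int (n choose j) * ((- 1) ^ (l + j) * int (j choose l) * f l)"
  have inner: "(\<Sum>j\<in>{l..n}. ?h j l) = (if l = n then f n else 0)" if "l \<le> n" for l
  proof -
    have "(\<Sum>j\<in>{l..n}. ?h j l) = (\<Sum>i\<le>n-l. ?h (i + l) l)"
      using that sum.shift_bounds_cl_nat_ivl[of "\<lambda>j. ?h j l" 0 l "n - l"]
      by (simp add: atLeast0AtMost)
    also have "\<dots> = (\<Sum>i\<le>n-l. int (n choose l) * f l * ((- 1) ^ i * int ((n - l) choose i)))"
    proof (intro sum.cong refl)
      fix i assume "i \<in> {..n - l}"
      then have "i + l \<le> n" using that by simp
      then have "(n choose (i + l)) * ((i + l) choose l) = (n choose l) * ((n - l) choose i)"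
        using choose_mult[of l "i + l" n] by simp
      then have "int (n choose (i + l)) * int ((i + l) choose l)
          = int (n choose l) * int ((n - l) choose i)"
        by (metis of_nat_mult)
      moreover have "(- 1 :: int) ^ (l + (i + l)) = (- 1) ^ i"
        by (simp add: power_add flip: mult_2)
      ultimately show "?h (i + l) l = int (n choose l) * f l * ((- 1) ^ i * int ((n - l) choose i))"
        by (simp add: algebra_simps)
    qed
    also have "\<dots> = int (n choose l) * f l * (\<Sum>i\<le>n-l. (- 1) ^ i * int ((n - l) choose i))"
      by (simp add: sum_distrib_left)
    also have "\<dots> = (if l = n then f n else 0)"
      using choose_alternating_sum[of "n - l", where 'a = int] that by auto
    finally show ?thesis .
  qed
  have "(\<Sum>j\<le>n. int (n choose j) * a j) = (\<Sum>j\<le>n. \<Sum>l\<in>{l\<in>{..n}. l \<le> j}. ?h j l)"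
    by (intro sum.cong refl) (auto simp: a sum_distrib_left intro!: sum.cong)
  also have "\<dots> = (\<Sum>l\<le>n. \<Sum>j\<in>{j\<in>{..n}. l \<le> j}. ?h j l)"
    by (rule sum.swap_restrict) auto
  also have "\<dots> = (\<Sum>l\<le>n. \<Sum>j\<in>{l..n}. ?h j l)"
    by (intro sum.cong refl) auto
  also have "\<dots> = (\<Sum>l\<le>n. if l = n then f n else 0)"
    by (intro sum.cong refl inner) simp
  also have "\<dots> = f n" by simp
  finally show ?thesis by simp
qed

definition degree :: "'a set multiset \<Rightarrow> 'a set \<Rightarrow> nat" where
  "degree \<B> Z = size {#B \<in># \<B>. Z \<subseteq> B#}"

lemma degree_simps [simp]:
  "degree {#} Z = 0"
  "degree (add_mset B \<B>) Z = of_bool (Z \<subseteq> B) + degree \<B> Z"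
  by (auto simp: degree_def)

lemma sum_degree:
  assumes "finite \<F>"
  shows "(\<Sum>Y\<in>\<F>. degree \<B> (X \<union> Y)) = (\<Sum>B\<in>#{#B \<in># \<B>. X \<subseteq> B#}. card {Y\<in>\<F>. Y \<subseteq> B})"
proof (induction \<B>)
  case (add B \<B>)
  have "(\<Sum>Y\<in>\<F>. of_bool (Y \<subseteq> B)) = card {Y\<in>\<F>. Y \<subseteq> B}"
    using assms by (simp add: Int_def)
  then show ?case using add by (simp add: sum.distrib)
qed simp

text \<open>Count the pairs of a block \<open>B\<close> containing \<open>X\<close> and an \<open>s\<close>-subset \<open>Y\<close> of \<open>B\<close>. For \<open>X = {}\<close> this is
  the total number of incidences, and for an \<open>s\<close>-subset \<open>X\<close> a row sum of the Gram matrix.\<close>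

lemma sum_degree_subsets:
  assumes "finite V" "\<forall>B\<in>#\<B>. B \<subseteq> V \<and> card B = k"
  shows "(\<Sum>Y | Y \<subseteq> V \<and> card Y = s. degree \<B> (X \<union> Y)) = degree \<B> X * (k choose s)"
proof -
  have "card {Y\<in>{Y. Y \<subseteq> V \<and> card Y = s}. Y \<subseteq> B} = k choose s" if "B \<in># \<B>" for B
  proof -
    have "{Y\<in>{Y. Y \<subseteq> V \<and> card Y = s}. Y \<subseteq> B} = {Y. Y \<subseteq> B \<and> card Y = s}"
      using assms(2) that by auto
    moreover have "finite B" using assms that finite_subset by blast
    ultimately show ?thesis using assms(2) that by (simp add: n_subsets)
  qed
  then have "image_mset (\<lambda>B. card {Y\<in>{Y. Y \<subseteq> V \<and> card Y = s}. Y \<subseteq> B}) {#B \<in># \<B>. X \<subseteq> B#}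
      = image_mset (\<lambda>_. k choose s) {#B \<in># \<B>. X \<subseteq> B#}"
    by (intro image_mset_cong) auto
  then show ?thesis
    using assms(1) by (subst sum_degree) (auto simp: degree_def sum_mset_constant)
qed

text \<open>A block contains both \<open>X\<close> and \<open>Y\<close> iff it contains their union, so degrees of unions are the
  entries of the Gram matrix.\<close>

lemma gram_form:
  fixes u :: "'a set \<Rightarrow> real"
  shows "(\<Sum>B\<in>#\<B>. (\<Sum>X\<in>R. u X * of_bool (X \<subseteq> B))\<^sup>2)
    = (\<Sum>X\<in>R. \<Sum>Y\<in>R. u X * u Y * degree \<B> (X \<union> Y))"
proof (induction \<B>)
  case (add B \<B>)
  have "(\<Sum>X\<in>R. u X * of_bool (X \<subseteq> B))\<^sup>2
      = (\<Sum>X\<in>R. \<Sum>Y\<in>R. u X * u Y * of_bool (X \<union> Y \<subseteq> B))"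
    by (auto simp: power2_eq_square sum_product intro!: sum.cong)
  with add show ?case
    by (simp add: distrib_left sum.distrib)
qed simp

lemma card_subsets_with_intersection:
  assumes "finite V" "X \<subseteq> V" "i \<le> s"
  shows "card {Y. Y \<subseteq> V \<and> card Y = s \<and> card (X \<inter> Y) = i}
    = (card X choose i) * (card (V - X) choose (s - i))"
proof -
  have fin: "finite X" "finite (V - X)" using assms finite_subset by auto
  let ?I = "{A. A \<subseteq> X \<and> card A = i} \<times> {C. C \<subseteq> V - X \<and> card C = s - i}"
  have "bij_betw (\<lambda>(A, C). A \<union> C) ?I {Y. Y \<subseteq> V \<and> card Y = s \<and> card (X \<inter> Y) = i}"
  proof (rule bij_betw_byWitness[where f' = "\<lambda>Y. (X \<inter> Y, Y - X)"])
    show "(\<lambda>(A, C). A \<union> C) ` ?I \<subseteq> {Y. Y \<subseteq> V \<and> card Y = s \<and> card (X \<inter> Y) = i}"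
    proof (clarsimp, intro conjI)
      fix A C assume AC: "A \<subseteq> X" "i = card A" "C \<subseteq> V - X" "card C = s - card A"
      have "finite A" "finite C" "A \<inter> C = {}" using AC fin finite_subset by blast+
      then show "card (A \<union> C) = s" using AC assms(3) by (simp add: card_Un_disjoint)
      have "X \<inter> (A \<union> C) = A" using AC by auto
      then show "card (X \<inter> (A \<union> C)) = card A" by simp
      show "A \<subseteq> V" "C \<subseteq> V" using AC assms(2) by auto
    qed
    show "(\<lambda>Y. (X \<inter> Y, Y - X)) ` {Y. Y \<subseteq> V \<and> card Y = s \<and> card (X \<inter> Y) = i} \<subseteq> ?I"
    proof clarsimp
      fix Y assume Y: "Y \<subseteq> V" "s = card Y" "i = card (X \<inter> Y)"
      have "finite Y" using Y assms(1) finite_subset by auto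
      then show "Y - X \<subseteq> V - X \<and> card (Y - X) = card Y - card (X \<inter> Y)"
        using Y by (auto simp: card_Diff_subset_Int Int_commute)
    qed
  qed auto
  from bij_betw_same_card[OF this] show ?thesis
    using fin by (simp add: card_cartesian_product n_subsets)
qed

lemma sum_by_intersection:
  fixes h :: "nat \<Rightarrow> nat"
  assumes "finite V" "X \<subseteq> V" "card X = s"
  shows "(\<Sum>Y | Y \<subseteq> V \<and> card Y = s. h (card (X \<inter> Y)))
    = (\<Sum>i\<le>s. (s choose i) * ((card V - s) choose (s - i)) * h i)"
proof -
  let ?F = "{Y. Y \<subseteq> V \<and> card Y = s}"
  have fin: "finite ?F" "finite X" using assms finite_subset by auto
  have "(\<lambda>Y. card (X \<inter> Y)) ` ?F \<subseteq> {..s}"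
    using assms(3) fin(2) by (auto intro: card_mono)
  then have "(\<Sum>Y\<in>?F. h (card (X \<inter> Y)))
      = (\<Sum>i\<le>s. \<Sum>Y\<in>{Y\<in>?F. card (X \<inter> Y) = i}. h (card (X \<inter> Y)))"
    using fin by (intro sum.group[symmetric]) auto
  also have "\<dots> = (\<Sum>i\<le>s. card {Y. Y \<subseteq> V \<and> card Y = s \<and> card (X \<inter> Y) = i} * h i)"
    by (intro sum.cong refl) (simp add: conj_assoc)
  also have "\<dots> = (\<Sum>i\<le>s. (s choose i) * ((card V - s) choose (s - i)) * h i)"
  proof (intro sum.cong refl)
    fix i assume "i \<in> {..s}"
    then show "card {Y. Y \<subseteq> V \<and> card Y = s \<and> card (X \<inter> Y) = i} * h i
        = (s choose i) * ((card V - s) choose (s - i)) * h i"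
      using assms fin card_subsets_with_intersection[of V X i s] by (simp add: card_Diff_subset)
  qed
  finally show ?thesis .
qed

text \<open>A binomial coefficient of \<open>card (X \<inter> Y)\<close> counts the common \<open>j\<close>-subsets of \<open>X\<close> and \<open>Y\<close>, so its
  matrix is the Gram matrix of the containment vectors of \<open>j\<close>-subsets. For \<open>j = s\<close> it is the
  identity matrix.\<close>

lemma intersection_form_ge:
  fixes u :: "'a set \<Rightarrow> real" and a :: "nat \<Rightarrow> real"
  assumes "finite V" and R: "R \<subseteq> {X. X \<subseteq> V \<and> card X = s}"
    and a: "\<And>j. j \<le> s \<Longrightarrow> 0 \<le> a j"
  shows "a s * (\<Sum>X\<in>R. (u X)\<^sup>2)
    \<le> (\<Sum>X\<in>R. \<Sum>Y\<in>R. u X * u Y * (\<Sum>j\<le>s. (card (X \<inter> Y) choose j) * a j))"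
proof -
  let ?q = "\<lambda>j. \<Sum>X\<in>R. \<Sum>Y\<in>R. u X * u Y * (card (X \<inter> Y) choose j)"
  have "finite {X. X \<subseteq> V \<and> card X = s}" using assms(1) by simp
  then have finR: "finite R" using R finite_subset by blast
  have nonneg: "0 \<le> ?q j" for j
  proof -
    let ?T = "{T. T \<subseteq> V \<and> card T = j}"
    have "real (card (X \<inter> Y) choose j) = (\<Sum>T\<in>?T. of_bool (T \<subseteq> X) * of_bool (T \<subseteq> Y))"
      if "X \<in> R" for X Y
    proof -
      have X: "X \<subseteq> V" using that R by auto
      then have "finite (X \<inter> Y)" using assms(1) finite_subset by auto
      then have "card (X \<inter> Y) choose j = card {T. T \<subseteq> X \<inter> Y \<and> card T = j}"
        by (rule n_subsets[symmetric])
      also have "{T. T \<subseteq> X \<inter> Y \<and> card T = j} = {T\<in>?T. T \<subseteq> X \<and> T \<subseteq> Y}" using X by auto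
      also have "real (card \<dots>) = (\<Sum>T\<in>?T. of_bool (T \<subseteq> X \<and> T \<subseteq> Y))"
        using assms(1) by (simp add: Int_def conj_ac)
      finally show ?thesis by (simp add: of_bool_conj)
    qed
    then have "?q j = (\<Sum>X\<in>R. \<Sum>Y\<in>R. \<Sum>T\<in>?T. (u X * of_bool (T \<subseteq> X)) * (u Y * of_bool (T \<subseteq> Y)))"
      by (intro sum.cong refl) (simp add: sum_distrib_left mult_ac)
    also have "\<dots> = (\<Sum>X\<in>R. \<Sum>T\<in>?T. \<Sum>Y\<in>R. (u X * of_bool (T \<subseteq> X)) * (u Y * of_bool (T \<subseteq> Y)))"
      by (intro sum.cong refl sum.swap)
    also have "\<dots> = (\<Sum>T\<in>?T. \<Sum>X\<in>R. \<Sum>Y\<in>R. (u X * of_bool (T \<subseteq> X)) * (u Y * of_bool (T \<subseteq> Y)))"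
      by (rule sum.swap)
    also have "\<dots> = (\<Sum>T\<in>?T. (\<Sum>X\<in>R. u X * of_bool (T \<subseteq> X))\<^sup>2)"
      by (simp only: power2_eq_square sum_product)
    also have "\<dots> \<ge> 0" by (intro sum_nonneg) auto
    finally show ?thesis .
  qed
  have diag: "card (X \<inter> Y) choose s = of_bool (X = Y)" if "X \<in> R" "Y \<in> R" for X Y
  proof (cases "X = Y")
    case True then show ?thesis using that R by auto
  next
    case False
    have XY: "X \<subseteq> V" "Y \<subseteq> V" "card X = s" "card Y = s" using that R by auto
    then have fin: "finite X" "finite Y" using assms(1) finite_subset by auto
    then have "X \<inter> Y \<subset> X"
      using False card_subset_eq[of Y X] fin XY by auto
    then have "card (X \<inter> Y) < s" using psubset_card_mono[of X "X \<inter> Y"] fin XY by simp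
    then show ?thesis using False by simp
  qed
  have "?q s = (\<Sum>X\<in>R. \<Sum>Y\<in>R. u X * u Y * of_bool (X = Y))"
    by (intro sum.cong refl) (simp add: diag)
  also have "\<dots> = (\<Sum>X\<in>R. (u X)\<^sup>2)"
    using finR by (intro sum.cong refl) (simp add: power2_eq_square Int_absorb2 of_bool_def if_distrib cong: if_cong)
  finally have qs: "?q s = (\<Sum>X\<in>R. (u X)\<^sup>2)" .
  have "(\<Sum>X\<in>R. \<Sum>Y\<in>R. u X * u Y * (\<Sum>j\<le>s. (card (X \<inter> Y) choose j) * a j))
      = (\<Sum>X\<in>R. \<Sum>Y\<in>R. \<Sum>j\<le>s. a j * (u X * u Y * (card (X \<inter> Y) choose j)))"
    by (simp add: sum_distrib_left mult_ac)
  also have "\<dots> = (\<Sum>X\<in>R. \<Sum>j\<le>s. \<Sum>Y\<in>R. a j * (u X * u Y * (card (X \<inter> Y) choose j)))"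
    by (intro sum.cong refl sum.swap)
  also have "\<dots> = (\<Sum>j\<le>s. \<Sum>X\<in>R. \<Sum>Y\<in>R. a j * (u X * u Y * (card (X \<inter> Y) choose j)))"
    by (rule sum.swap)
  also have "\<dots> = (\<Sum>j\<le>s. a j * ?q j)"
    by (simp only: sum_distrib_left)
  also have "\<dots> \<ge> (\<Sum>j\<in>{s}. a j * ?q j)"
    using a nonneg by (intro sum_mono2) (auto intro!: mult_nonneg_nonneg)
  finally show ?thesis using qs by simp
qed

section \<open>Coverings and derived coverings\<close>

text \<open>All \<open>k\<close>-subsets, each repeated \<open>l\<close> times, form a covering. This makes the covering number an
  attained minimum.\<close>

lemma covering_exists:
  assumes "t \<le> k" "k \<le> v"
  shows "\<exists>(V :: nat set) \<B>. covering t v k l V \<B>"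
proof (intro exI)
  let ?V = "{..<v}" and ?K = "{B. B \<subseteq> {..<v} \<and> card B = k}"
  have fin: "finite ?K" by simp
  have "l \<le> degree (repeat_mset l (mset_set ?K)) T" if T: "T \<subseteq> ?V" "card T = t" for T
  proof -
    have "k - t \<le> card (?V - T)"
      using T assms by (simp add: card_Diff_subset finite_subset)
    then obtain C where C: "C \<subseteq> ?V - T" "card C = k - t" "finite C"
      using obtain_subset_with_card_n by blast
    have "finite T" using T finite_subset by auto
    then have "card (T \<union> C) = k"
      using C T assms by (subst card_Un_disjoint) auto
    then have TC: "T \<union> C \<in> ?K" using T C by auto
    have "replicate_mset l (T \<union> C) \<subseteq># {#B \<in># repeat_mset l (mset_set ?K). T \<subseteq> B#}"
      using TC fin by (intro mset_subset_eqI) auto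
    from size_mset_mono[OF this] show ?thesis by (simp add: degree_def)
  qed
  moreover have "B \<in> ?K" if "B \<in># repeat_mset l (mset_set ?K)" for B
  proof -
    have "0 < count (repeat_mset l (mset_set ?K)) B"
      using that by (simp only: count_greater_zero_iff)
    then have "B \<in># mset_set ?K" by (simp only: count_repeat_mset nat_0_less_mult_iff count_greater_zero_iff)
    then show ?thesis using fin by simp
  qed
  ultimately show "covering t v k l ?V (repeat_mset l (mset_set ?K))"
    unfolding covering_def incidence_structure_def degree_def
    by (intro conjI ballI allI impI finite_lessThan card_lessThan) blast+
qed

lemma covering_number_attained:
  assumes "0 < t" "t \<le> k" "k \<le> v"
  obtains V :: "nat set" and \<B> where "covering t v k l V \<B>" "size \<B> = covering_number l v k t"
proof -
  from covering_exists[OF assms(2,3), of l] obtain V0 :: "nat set" and \<B>0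
    where "covering t v k l V0 \<B>0" by blast
  then have "\<exists>n. \<exists>(V :: nat set) \<B>. covering t v k l V \<B> \<and> size \<B> = n" by blast
  from LeastI_ex[OF this] show ?thesis
    using assms(1) that by (auto simp: covering_number_def)
qed

text \<open>The blocks through \<open>Z\<close>, with \<open>Z\<close> removed, form a covering of the remaining points: the derived
  covering. For \<open>i = t\<close> there is nothing left to cover and the bound is the defining one.\<close>

lemma degree_ge_covering_number:
  fixes V :: "nat set"
  assumes cov: "covering t v k l V \<B>" and Z: "Z \<subseteq> V" "card Z = i" "i \<le> t"
  shows "covering_number l (v - i) (k - i) (t - i) \<le> degree \<B> Z"
proof (cases "i = t")
  case True
  have "l \<le> degree \<B> Z"
    using cov Z(1,2) True unfolding covering_def degree_def by blast
  then show ?thesis using True by (simp add: covering_number_def)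
next
  case False
  let ?D = "image_mset (\<lambda>B. B - Z) {#B \<in># \<B>. Z \<subseteq> B#}"
  have V: "finite V" "card V = v" and \<B>: "\<forall>B\<in>#\<B>. B \<subseteq> V \<and> card B = k"
    and T: "\<And>T. T \<subseteq> V \<Longrightarrow> card T = t \<Longrightarrow> l \<le> degree \<B> T"
    using cov unfolding covering_def incidence_structure_def degree_def by blast+
  have finZ: "finite Z" using V Z finite_subset by auto
  have "l \<le> degree ?D T" if T': "T \<subseteq> V - Z" "card T = t - i" for T
  proof -
    have "finite T" using T' V finite_subset by auto
    then have "card (T \<union> Z) = t" using T' Z finZ by (subst card_Un_disjoint) auto
    then have "l \<le> degree \<B> (T \<union> Z)" using T' Z by (intro T) auto
    also have "{#B \<in># \<B>. T \<union> Z \<subseteq> B#} = {#B \<in># \<B>. Z \<subseteq> B \<and> T \<subseteq> B - Z#}"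
      using T' by (intro filter_mset_cong) auto
    then have "degree \<B> (T \<union> Z) = degree ?D T"
      by (simp add: degree_def filter_mset_image_mset filter_filter_mset conj_commute)
    finally show ?thesis .
  qed
  moreover have "card B = k \<Longrightarrow> Z \<subseteq> B \<Longrightarrow> card (B - Z) = k - i" for B
    using finZ Z by (simp add: card_Diff_subset)
  ultimately have "covering (t - i) (v - i) (k - i) l (V - Z) ?D"
    using V \<B> Z finZ
    unfolding covering_def incidence_structure_def degree_def by (auto simp: card_Diff_subset)
  then have "(LEAST n. \<exists>(W :: nat set) \<D>. covering (t - i) (v - i) (k - i) l W \<D> \<and> size \<D> = n)
      \<le> size ?D" by (intro Least_le) blast
  then show ?thesis using False Z by (simp add: covering_number_def degree_def)
qed

section \<open>The excess of a covering\<close>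

text \<open>The assumption \<open>b_expand\<close> is the inverted form of the definition of \<open>a\<close>.\<close>

locale covering_excess =
  fixes V :: "'a set" and \<B> :: "'a set multiset" and v k s :: nat
    and b :: "nat \<Rightarrow> nat" and a :: "nat \<Rightarrow> int"
  assumes finite_V: "finite V" and card_V: "card V = v"
    and blocks: "\<forall>B\<in>#\<B>. B \<subseteq> V \<and> card B = k"
    and degree_ge: "\<lbrakk>Z \<subseteq> V; s \<le> card Z; card Z \<le> 2 * s\<rbrakk> \<Longrightarrow> b (card Z) \<le> degree \<B> Z"
    and b_expand: "i \<le> s \<Longrightarrow> int (b (2 * s - i)) = (\<Sum>j\<le>i. int (i choose j) * a j)"
    and a_nonneg: "j \<le> s \<Longrightarrow> 0 \<le> a j"
begin

definition \<F> :: "'a set set" where "\<F> = {X. X \<subseteq> V \<and> card X = s}"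

definition excess :: "'a set \<Rightarrow> 'a set \<Rightarrow> nat" where
  "excess X Y = degree \<B> (X \<union> Y) - b (card (X \<union> Y))"

lemma finite_F: "finite \<F>" unfolding \<F>_def using finite_V by simp

lemma excess_sym: "excess X Y = excess Y X"
  by (simp add: excess_def Un_commute)

lemma degree_union:
  assumes "X \<in> \<F>" "Y \<in> \<F>"
  shows "card (X \<inter> Y) \<le> s"
    and "degree \<B> (X \<union> Y) = excess X Y + b (2 * s - card (X \<inter> Y))"
proof -
  have fin: "finite X" "finite Y" using assms finite_V finite_subset by (auto simp: \<F>_def)
  have c: "card X = s" "card Y = s" using assms by (auto simp: \<F>_def)
  show le: "card (X \<inter> Y) \<le> s" using fin c card_mono[of X "X \<inter> Y"] by auto
  have u: "card (X \<union> Y) = 2 * s - card (X \<inter> Y)"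
    using card_Un_Int[OF fin] c by simp
  have "b (card (X \<union> Y)) \<le> degree \<B> (X \<union> Y)"
    using assms le u by (intro degree_ge) (auto simp: \<F>_def)
  then show "degree \<B> (X \<union> Y) = excess X Y + b (2 * s - card (X \<inter> Y))"
    by (simp add: excess_def u)
qed

lemma excess_self: "X \<in> \<F> \<Longrightarrow> degree \<B> X = b s + excess X X"
  using degree_union(2)[of X X] by (auto simp: \<F>_def mult_2)

text \<open>The row sum of the Gram matrix is known, and so is that of the lower bounds \<open>b\<close>; the diagonal
  entry is moved to the other side.\<close>

lemma excess_row_sum:
  assumes "X \<in> \<F>"
  shows "int (\<Sum>Y\<in>\<F>-{X}. excess X Y)
    = int (degree \<B> X) * (int (k choose s) - 1)
      - (\<Sum>i<s. int (s choose i) * int ((v - s) choose (s - i)) * int (b (2 * s - i)))"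
proof -
  have "degree \<B> X * (k choose s) = (\<Sum>Y\<in>\<F>. degree \<B> (X \<union> Y))"
    unfolding \<F>_def by (rule sum_degree_subsets[OF finite_V blocks, symmetric])
  also have "\<dots> = (\<Sum>Y\<in>\<F>. excess X Y + b (2 * s - card (X \<inter> Y)))"
    using assms degree_union(2) by (intro sum.cong) auto
  also have "\<dots> = (\<Sum>Y\<in>\<F>. excess X Y) + (\<Sum>Y\<in>\<F>. b (2 * s - card (X \<inter> Y)))"
    by (rule sum.distrib)
  also have "(\<Sum>Y\<in>\<F>. excess X Y) = excess X X + (\<Sum>Y\<in>\<F>-{X}. excess X Y)"
    using assms finite_F by (rule sum.remove[rotated])
  also have "(\<Sum>Y\<in>\<F>. b (2 * s - card (X \<inter> Y)))
      = (\<Sum>i\<le>s. (s choose i) * ((v - s) choose (s - i)) * b (2 * s - i))"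
    unfolding \<F>_def using sum_by_intersection[of V X s "\<lambda>i. b (2 * s - i)"] assms finite_V card_V
    by (simp add: \<F>_def)
  also have "\<dots> = (\<Sum>i<s. (s choose i) * ((v - s) choose (s - i)) * b (2 * s - i)) + b s"
    by (simp add: mult_2 flip: lessThan_Suc_atMost)
  finally have "int (degree \<B> X * (k choose s)) = int (excess X X + (\<Sum>Y\<in>\<F>-{X}. excess X Y)
      + ((\<Sum>i<s. (s choose i) * ((v - s) choose (s - i)) * b (2 * s - i)) + b s))"
    by simp
  then show ?thesis using excess_self[OF assms] by (simp add: algebra_simps)
qed

text \<open>The Gram matrix dominates, as a quadratic form, the matrix with \<open>a s\<close> plus the excess on the
  diagonal and the excess elsewhere.\<close>

lemma gram_form_ge:
  fixes u :: "'a set \<Rightarrow> real"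
  assumes "R \<subseteq> \<F>"
  shows "(\<Sum>X\<in>R. (a s + excess X X) * (u X)\<^sup>2) + (\<Sum>X\<in>R. \<Sum>Y\<in>R-{X}. excess X Y * (u X * u Y))
    \<le> (\<Sum>B\<in>#\<B>. (\<Sum>X\<in>R. u X * of_bool (X \<subseteq> B))\<^sup>2)"
proof -
  have finR: "finite R" using assms finite_F finite_subset by blast
  have coeff: "real (b (2 * s - card (X \<inter> Y))) = (\<Sum>j\<le>s. (card (X \<inter> Y) choose j) * real_of_int (a j))"
    if "X \<in> R" "Y \<in> R" for X Y
  proof -
    let ?i = "card (X \<inter> Y)"
    have le: "?i \<le> s" using degree_union(1) that assms by blast
    have "real (b (2 * s - ?i)) = real_of_int (int (b (2 * s - ?i)))" by simp
    also have "\<dots> = (\<Sum>j\<le>?i. (?i choose j) * real_of_int (a j))"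
      unfolding b_expand[OF le] by simp
    also have "\<dots> = (\<Sum>j\<le>s. (?i choose j) * real_of_int (a j))"
      using le by (intro sum.mono_neutral_left) auto
    finally show ?thesis .
  qed
  have "(\<Sum>B\<in>#\<B>. (\<Sum>X\<in>R. u X * of_bool (X \<subseteq> B))\<^sup>2)
      = (\<Sum>X\<in>R. \<Sum>Y\<in>R. u X * u Y * degree \<B> (X \<union> Y))"
    by (rule gram_form)
  also have "\<dots> = (\<Sum>X\<in>R. \<Sum>Y\<in>R. excess X Y * (u X * u Y)
      + u X * u Y * (\<Sum>j\<le>s. (card (X \<inter> Y) choose j) * real_of_int (a j)))"
  proof (intro sum.cong refl)
    fix X Y assume XY: "X \<in> R" "Y \<in> R"
    then have "real (degree \<B> (X \<union> Y)) = excess X Y + real (b (2 * s - card (X \<inter> Y)))"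
      using degree_union(2) assms by (metis of_nat_add subsetD)
    then show "u X * u Y * degree \<B> (X \<union> Y) = excess X Y * (u X * u Y)
        + u X * u Y * (\<Sum>j\<le>s. (card (X \<inter> Y) choose j) * real_of_int (a j))"
      unfolding coeff[OF XY] by (simp add: distrib_left mult.commute)
  qed
  also have "\<dots> = (\<Sum>X\<in>R. \<Sum>Y\<in>R. excess X Y * (u X * u Y))
      + (\<Sum>X\<in>R. \<Sum>Y\<in>R. u X * u Y * (\<Sum>j\<le>s. (card (X \<inter> Y) choose j) * real_of_int (a j)))"
    by (simp only: sum.distrib)
  also have "(\<Sum>X\<in>R. \<Sum>Y\<in>R. excess X Y * (u X * u Y))
      = (\<Sum>X\<in>R. excess X X * (u X)\<^sup>2 + (\<Sum>Y\<in>R-{X}. excess X Y * (u X * u Y)))"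
    using finR by (intro sum.cong refl) (simp add: sum.remove power2_eq_square)
  finally have eq: "(\<Sum>B\<in>#\<B>. (\<Sum>X\<in>R. u X * of_bool (X \<subseteq> B))\<^sup>2)
      = (\<Sum>X\<in>R. excess X X * (u X)\<^sup>2 + (\<Sum>Y\<in>R-{X}. excess X Y * (u X * u Y)))
        + (\<Sum>X\<in>R. \<Sum>Y\<in>R. u X * u Y * (\<Sum>j\<le>s. (card (X \<inter> Y) choose j) * real_of_int (a j)))" .
  have "a s * (\<Sum>X\<in>R. (u X)\<^sup>2)
      \<le> (\<Sum>X\<in>R. \<Sum>Y\<in>R. u X * u Y * (\<Sum>j\<le>s. (card (X \<inter> Y) choose j) * real_of_int (a j)))"
    using assms a_nonneg finite_V by (intro intersection_form_ge) (auto simp: \<F>_def)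
  then show ?thesis unfolding eq
    by (simp add: distrib_right sum.distrib sum_distrib_left)
qed

text \<open>The rows of the incidence matrix indexed by \<open>P \<union> S\<close> are independent. The diagonal excess supplies
  the difference between \<open>a s\<close> for \<open>P\<close> and \<open>a s + 1\<close> for \<open>S\<close>.\<close>

lemma card_light_le_size:
  fixes d :: nat
  assumes P: "P \<subseteq> {X\<in>\<F>. excess X X = 0}" and S: "S \<subseteq> {X\<in>\<F>. excess X X = 1}"
    and da: "d < a s" and rows: "\<And>X. X \<in> P \<Longrightarrow> (\<Sum>Y\<in>\<F>-{X}. excess X Y) \<le> d"
    and light: "\<And>Y. Y \<in> S \<Longrightarrow> load (d / a s) excess P S Y < real_of_int (a s) + 1"
  shows "card P + card S \<le> size \<B>"
proof -
  have sub: "P \<union> S \<subseteq> \<F>" using P S by auto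
  have disj: "P \<inter> S = {}"
  proof -
    have "excess X X = 0" if "X \<in> P" for X using P that by blast
    moreover have "excess X X = 1" if "X \<in> S" for X using S that by blast
    ultimately show ?thesis by fastforce
  qed
  have fin: "finite P" "finite S" using sub finite_F finite_subset by auto
  have da': "real d < real_of_int (a s)" using da by linarith
  have "card (P \<union> S) \<le> size \<B>"
  proof (rule card_le_size_if_positive_definite[where f = "\<lambda>X B. of_bool (X \<subseteq> B)"])
    fix u :: "'a set \<Rightarrow> real" assume u: "\<exists>X\<in>P\<union>S. u X \<noteq> 0"
    have "(\<Sum>Y\<in>P\<union>S-{X}. excess X Y) \<le> d" if "X \<in> P" for X
      using rows[OF that] sub finite_F sum_mono2[of "\<F> - {X}" "P \<union> S - {X}" "excess X"] by fastforce
    from light_set_positive_definite[of P S excess, OF fin disj excess_sym da' this light u]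
    have "0 < (\<Sum>X\<in>P\<union>S. (if X \<in> P then real_of_int (a s) else real_of_int (a s) + 1) * (u X)\<^sup>2)
      + (\<Sum>X\<in>P\<union>S. \<Sum>Y\<in>P\<union>S-{X}. excess X Y * (u X * u Y))" by simp
    also have "(\<Sum>X\<in>P\<union>S. (if X \<in> P then real_of_int (a s) else real_of_int (a s) + 1) * (u X)\<^sup>2)
        = (\<Sum>X\<in>P\<union>S. (a s + excess X X) * (u X)\<^sup>2)"
      using P S by (intro sum.cong) auto
    also note gram_form_ge[OF sub]
    finally show "0 < (\<Sum>B\<in>#\<B>. (\<Sum>X\<in>P\<union>S. u X * of_bool (X \<subseteq> B))\<^sup>2)" .
  qed (use fin in simp)
  then show ?thesis using fin disj by (simp add: card_Un_disjoint)
qed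

end

section \<open>Arithmetic of the parameters\<close>

text \<open>Here \<open>n0\<close>, \<open>n1\<close>, \<open>n2\<close> count the \<open>s\<close>-subsets in exactly \<open>bs\<close>, exactly \<open>bs + 1\<close> and at least
  \<open>bs + 2\<close> blocks. Replacing an \<open>s\<close>-subset of the first kind by one of the second lowers
  the rank bound by \<open>\<alpha> - \<beta>\<close> and takes one more incidence. As \<open>\<alpha> \<le> 2 (\<alpha> - \<beta>)\<close>, ignoring those of the
  third kind costs no more per incidence. Eliminating \<open>n0\<close>, \<open>n1\<close>, \<open>n2\<close> leaves \<open>CB\<close>.\<close>

lemma CB_le:
  assumes rank: "\<alpha> * n0 + \<beta> * n1 \<le> n" and ab: "\<beta> \<le> \<alpha> / 2" "0 \<le> \<alpha>"
    and total: "bs * (v choose s) + n1 + 2 * n2 \<le> n * (k choose s)"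
    and split: "(v choose s) = n0 + n1 + n2"
  shows "CB v k s bs \<alpha> \<beta> \<le> n"
proof -
  let ?N = "real (v choose s)" and ?K = "real (k choose s)"
  have g: "0 \<le> \<alpha> - \<beta>" "\<alpha> \<le> 2 * (\<alpha> - \<beta>)" using ab by auto
  have N: "?N = n0 + n1 + n2" using split by simp
  have "real (bs * (v choose s) + n1 + 2 * n2) \<le> real (n * (k choose s))"
    using total of_nat_le_iff by blast
  then have t: "real n1 + 2 * real n2 \<le> n * ?K - bs * ?N" by simp
  have "\<alpha> * ?N - (\<alpha> - \<beta>) * (n * ?K - bs * ?N) \<le> \<alpha> * ?N - (\<alpha> - \<beta>) * (real n1 + 2 * real n2)"
    using mult_left_mono[OF t g(1)] by simp
  also have "\<dots> = \<alpha> * n0 + \<beta> * n1 - (2 * (\<alpha> - \<beta>) - \<alpha>) * n2"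
    by (simp add: N algebra_simps)
  also have "\<dots> \<le> \<alpha> * n0 + \<beta> * n1" using g(2) by simp
  also have "\<dots> \<le> n" by (rule rank)
  finally have "bs * (\<alpha> - \<beta>) * ?N + \<alpha> * ?N \<le> n * ((\<alpha> - \<beta>) * ?K + 1)"
    by (simp add: algebra_simps)
  moreover have "0 < (\<alpha> - \<beta>) * ?K + 1" using g by (simp add: add_nonneg_pos)
  ultimately show ?thesis by (simp add: CB_def pos_divide_le_eq)
qed

text \<open>The hypothesis is the ceiling condition linking consecutive \<open>b i\<close>, without ceilings and
  denominators; its telescoping product is a quotient of binomial coefficients.\<close>

lemma choose_mult_chain:
  fixes b :: "nat \<Rightarrow> nat"
  assumes "j \<le> s" "2 * s \<le> k" "k \<le> v"
    and step: "\<And>i. s \<le> i \<Longrightarrow> i \<le> 2 * s - 1 \<Longrightarrow> (v - i) * b (i + 1) \<le> (k - i) * b i"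
  shows "((v - s) choose j) * b (s + j) \<le> ((k - s) choose j) * b s"
  using assms(1)
proof (induction j)
  case (Suc j)
  have ab: "Suc j * (n choose Suc j) = (n choose j) * (n - j)" for n :: nat
    using binomial_absorption[of j n] binomial_absorb_comp[of n j] by (simp add: mult.commute)
  have "Suc j * (((v - s) choose Suc j) * b (s + Suc j))
      = ((v - s) choose j) * ((v - (s + j)) * b (s + j + 1))"
    by (simp only: mult.assoc[symmetric] ab) (simp add: mult.assoc)
  also have "\<dots> \<le> ((v - s) choose j) * ((k - (s + j)) * b (s + j))"
    using Suc.prems by (intro mult_left_mono step) auto
  also have "\<dots> = (k - (s + j)) * (((v - s) choose j) * b (s + j))" by (simp add: mult_ac)
  also have "\<dots> \<le> (k - (s + j)) * (((k - s) choose j) * b s)"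
    using Suc by (intro mult_left_mono) auto
  also have "\<dots> = Suc j * (((k - s) choose Suc j) * b s)"
    by (simp only: mult.assoc[symmetric] ab) (simp add: mult_ac)
  finally show ?case by (simp only: Suc_mult_le_cancel1)
qed simp

text \<open>The summands are estimated separately and added up with the Vandermonde identity. The inequality
  means that \<open>d \<ge> 0\<close>, so \<open>d\<close> is a possible degree even when no \<open>s\<close>-subset lies in exactly \<open>b s\<close>
  blocks.\<close>

lemma weighted_sum_le_choose:
  fixes b :: "nat \<Rightarrow> nat"
  assumes "2 * s \<le> k" "k \<le> v"
    and step: "\<And>i. s \<le> i \<Longrightarrow> i \<le> 2 * s - 1 \<Longrightarrow> (v - i) * b (i + 1) \<le> (k - i) * b i"
  shows "(\<Sum>i<s. (s choose i) * ((v - s) choose (s - i)) * b (2 * s - i)) + b s \<le> b s * (k choose s)"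
proof -
  have "(\<Sum>i<s. (s choose i) * ((v - s) choose (s - i)) * b (2 * s - i)) + b s
      = (\<Sum>i\<le>s. (s choose i) * (((v - s) choose (s - i)) * b (s + (s - i))))"
    by (simp add: mult_2 mult.assoc flip: lessThan_Suc_atMost)
  also have "\<dots> \<le> (\<Sum>i\<le>s. (s choose i) * (((k - s) choose (s - i)) * b s))"
    by (intro sum_mono mult_left_mono choose_mult_chain assms) auto
  also have "\<dots> = b s * (\<Sum>i\<le>s. (s choose i) * ((k - s) choose (s - i)))"
    by (simp add: sum_distrib_left mult_ac)
  also have "\<dots> = b s * (k choose s)"
    using vandermonde[of s "k - s" s] assms by simp
  finally show ?thesis .
qed

text \<open>This lemma and the next two verify \<open>\<beta> \<le> \<alpha> / 2\<close>, as \<open>CB_le\<close> requires, for the three choices of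
  \<open>\<alpha>\<close> and \<open>\<beta>\<close>. What makes \<open>\<beta>\<close> small is that \<open>d'\<close> exceeds \<open>a + d\<close>.\<close>

lemma ratio_a:
  fixes a d d' :: real
  assumes "0 \<le> d" "d < a" "a + 1 + d \<le> d'"
  defines "\<alpha> \<equiv> 1 - d\<^sup>2 / (2 * a * (a + 1))"
  shows "(a + 2) / (2 * (d' + 1)) \<le> \<alpha> / 2" "0 \<le> \<alpha>"
proof -
  have a: "0 < a" "0 < a + 2 + d" using assms(1,2) by linarith+
  then have pos: "0 < a" "0 < a + 2 + d" "0 < 2 * a * (a + 1)" by simp_all
  have "d * (a + 2 + d) \<le> a * (2 * (a + 1))" using assms(1,2) by (intro mult_mono) simp_all
  then have "d * (d * (a + 2 + d)) \<le> d * (2 * a * (a + 1))"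
    using assms(1) by (intro mult_left_mono) (simp_all add: mult_ac)
  then have 1: "d\<^sup>2 / (2 * a * (a + 1)) \<le> d / (a + 2 + d)"
    using pos by (simp add: divide_le_eq pos_le_divide_eq power2_eq_square mult_ac)
  have "(a + 2) / (d' + 1) \<le> (a + 2) / (a + 2 + d)"
    using assms(1-3) pos by (intro divide_left_mono mult_pos_pos) linarith+
  also have "\<dots> = 1 - d / (a + 2 + d)" using pos by (simp add: field_simps)
  also have "\<dots> \<le> \<alpha>" using 1 by (simp add: \<alpha>_def)
  finally have 2: "(a + 2) / (d' + 1) \<le> \<alpha>" .
  have "(a + 2) / (2 * (d' + 1)) = (a + 2) / (d' + 1) / 2" by simp
  also have "\<dots> \<le> \<alpha> / 2" using 2 by (intro divide_right_mono) simp_all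
  finally show "(a + 2) / (2 * (d' + 1)) \<le> \<alpha> / 2" .
  have "0 \<le> (a + 2) / (d' + 1)" using assms(1-3) by simp
  with 2 show "0 \<le> \<alpha>" by (rule order_trans[rotated])
qed

lemma ratio_b:
  fixes a d d' :: real
  assumes "0 < a" "a / 2 \<le> d" "a + 1 + d \<le> d'"
  shows "1 - d * d' / (a * (a + 1)) \<le> 1 / 2"
proof -
  have "a / 2 * (a + 1) \<le> d * d'" using assms by (intro mult_mono) auto
  then have "1 / 2 \<le> d * d' / (a * (a + 1))" using assms by (simp add: pos_le_divide_eq)
  then show ?thesis by linarith
qed

lemma ratio_c:
  fixes a d d' :: real
  assumes "0 \<le> d" "d < a" "a + 1 + d \<le> d'"
  shows "sqrt (d * (a + 2) / ((a + 1) * (a - d))) - d * (d' + 1) / (2 * (a + 1) * (a - d)) \<le> 1 / 2"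
proof -
  define q where "q = d / ((a + 1) * (a - d))"
  define z where "z = sqrt (q * (a + 2))"
  have q: "0 \<le> q" unfolding q_def using assms by (intro divide_nonneg_pos mult_pos_pos) auto
  then have "z\<^sup>2 = q * (a + 2)" using assms by (simp add: z_def)
  also have "\<dots> \<le> q * (d' + 1)" using q assms by (intro mult_left_mono) auto
  finally have "z\<^sup>2 / 2 \<le> q * (d' + 1) / 2" by simp
  \<comment> \<open>\<open>z - z\<^sup>2 / 2\<close> is at most its maximum, attained at \<open>z = 1\<close>\<close>
  moreover have "0 \<le> (z - 1)\<^sup>2" by simp
  then have "z - z\<^sup>2 / 2 \<le> 1 / 2" by (simp add: power2_diff)
  moreover have "z = sqrt (d * (a + 2) / ((a + 1) * (a - d)))" by (simp add: z_def q_def)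
  moreover have "q * (d' + 1) / 2 = d * (d' + 1) / (2 * (a + 1) * (a - d))"
    by (simp add: q_def mult.assoc) (simp add: algebra_simps)
  ultimately show ?thesis by linarith
qed

section \<open>The bound on the covering number\<close>

theorem theorem18:
  fixes t v k l s :: nat
    and b :: "nat \<Rightarrow> nat"
    and a :: "nat \<Rightarrow> int"
    and d d' :: int
    and \<alpha> \<beta> :: real
  assumes "0 < t" "0 < v" "0 < k" "0 < l" "0 < s"
    and "t < k" "k < v"
    and "s \<le> t div 2"
    and b_pos: "\<And>i. s \<le> i \<Longrightarrow> i \<le> 2 * s \<Longrightarrow> 0 < b i"
    and i_lower: "schoenheim l (v - 2 * s) (k - 2 * s) (t - 2 * s) \<le> int (b (2 * s))"
    and i_upper: "b (2 * s) \<le> covering_number l (v - 2 * s) (k - 2 * s) (t - 2 * s)"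
    and ii_lower: "\<And>i. s \<le> i \<Longrightarrow> i \<le> 2 * s - 1 \<Longrightarrow>
          \<lceil>real (v - i) / real (k - i) * real (b (i + 1))\<rceil> \<le> int (b i)"
    and ii_upper: "\<And>i. s \<le> i \<Longrightarrow> i \<le> 2 * s - 1 \<Longrightarrow>
          b i \<le> covering_number l (v - i) (k - i) (t - i)"
    and a_eq: "\<And>j. j \<le> s \<Longrightarrow>
          a j = (\<Sum>i = 0..j. (- 1) ^ (i + j) * int (j choose i) * int (b (2 * s - i)))"
    and iii: "\<And>j. j \<le> s \<Longrightarrow> 0 \<le> a j"
    and d_eq: "d = int (b s) * (int (k choose s) - 1) -
          (\<Sum>i = 0..s - 1. int (s choose i) * int ((v - s) choose (s - i)) * int (b (2 * s - i)))"
    and d'_eq: "d' = d + int (k choose s) - 1"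
    and "b s < k choose s"
    and "d < a s"
    and cases:
      "(\<alpha> = 1 - real_of_int (d ^ 2) / real_of_int (2 * a s * (a s + 1)) \<and>
        \<beta> = real_of_int (a s + 2) / real_of_int (2 * (d' + 1))) \<or>
       (\<alpha> = 1 \<and>
        \<beta> = 1 - real_of_int (d * d') / real_of_int (a s * (a s + 1)) \<and>
        real_of_int d \<ge> real_of_int (a s) / 2 \<and>
        d * d' < a s * (a s + 1)) \<or>
       (\<alpha> = 1 \<and>
        \<beta> = sqrt (real_of_int (d * (a s + 2)) / real_of_int ((a s + 1) * (a s - d)))
             - real_of_int (d * (d' + 1)) / real_of_int (2 * (a s + 1) * (a s - d)) \<and>
        real_of_int d < real_of_int (a s) / 2 \<and>
        d * (d' + 1) ^ 2 < 4 * (a s + 1) * (a s + 2) * (a s - d))"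
  shows "int (covering_number l v k t) \<ge> \<lceil>CB v k s (b s) \<alpha> \<beta>\<rceil>"
proof -
  have ts: "2 * s \<le> t" using \<open>s \<le> t div 2\<close> by simp
  have tk: "t < k" and kv: "k < v" and s0: "0 < s" by fact+

  have expand: "int (b (2 * s - i)) = (\<Sum>j\<le>i. int (i choose j) * a j)" if "i \<le> s" for i
    using that by (intro inverse_binomial[where f = "\<lambda>i. int (b (2 * s - i))"]) (simp add: a_eq)
  have step: "(v - i) * b (i + 1) \<le> (k - i) * b i" if "s \<le> i" "i \<le> 2 * s - 1" for i
  proof -
    have ki: "0 < real (k - i)" using that ts tk s0 by simp
    have "real (v - i) / real (k - i) * real (b (i + 1)) \<le> real (b i)"
      using ii_lower[OF that] by (simp add: ceiling_le_iff)
    then have "real ((v - i) * b (i + 1)) \<le> real ((k - i) * b i)"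
      using ki by (simp add: field_simps)
    then show ?thesis by (simp only: of_nat_le_iff)
  qed
  let ?T = "\<Sum>i<s. int (s choose i) * int ((v - s) choose (s - i)) * int (b (2 * s - i))"
  have d_T: "d = int (b s) * (int (k choose s) - 1) - ?T"
  proof -
    have "{0..s - 1} = {..<s}" using s0 by auto
    then show ?thesis using d_eq by simp
  qed
  have d0: "0 \<le> d"
  proof -
    have "int ((\<Sum>i<s. (s choose i) * ((v - s) choose (s - i)) * b (2 * s - i)) + b s)
        \<le> int (b s * (k choose s))"
      using weighted_sum_le_choose[of s k v b, OF _ _ step] ts tk kv by (simp only: of_nat_le_iff)
    then show ?thesis unfolding d_T by (simp add: algebra_simps)
  qed
  \<comment> \<open>\<open>b s\<close> exceeds \<open>a s\<close>, being at least \<open>a 0 + a s\<close> with \<open>a 0 = b (2 s) > 0\<close>; hence so does \<open>(k choose s) - 1\<close>\<close>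
  have d'_ge: "a s + 1 + d \<le> d'"
  proof -
    have "int (b s) = (\<Sum>j\<le>s. int (s choose j) * a j)"
      using expand[of s] by (simp add: mult_2)
    also have "\<dots> \<ge> (\<Sum>j\<in>{0, s}. int (s choose j) * a j)"
      using iii by (intro sum_mono2) auto
    finally have "a 0 + a s \<le> int (b s)" using s0 by simp
    moreover have "a 0 = int (b (2 * s))" using a_eq[of 0] by simp
    moreover have "0 < b (2 * s)" using s0 by (intro b_pos) auto
    ultimately show ?thesis using \<open>b s < k choose s\<close> d'_eq by linarith
  qed

  obtain V :: "nat set" and \<B> where cov: "covering t v k l V \<B>"
    and size: "size \<B> = covering_number l v k t"
    using covering_number_attained[of t k v l] \<open>0 < t\<close> tk kv by auto
  have V: "finite V" "card V = v" and blocks: "\<forall>B\<in>#\<B>. B \<subseteq> V \<and> card B = k"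
    using cov unfolding covering_def incidence_structure_def by blast+
  have deg: "b (card Z) \<le> degree \<B> Z" if Z: "Z \<subseteq> V" "s \<le> card Z" "card Z \<le> 2 * s" for Z
  proof -
    have "b (card Z) \<le> covering_number l (v - card Z) (k - card Z) (t - card Z)"
    proof (cases "card Z = 2 * s")
      case True
      then show ?thesis using i_upper by simp
    next
      case False
      then show ?thesis using Z by (intro ii_upper) auto
    qed
    also have "\<dots> \<le> degree \<B> Z"
      using Z ts tk by (intro degree_ge_covering_number[OF cov]) auto
    finally show ?thesis .
  qed
  interpret covering_excess V \<B> v k s b a
    by unfold_locales (use V blocks deg expand iii in auto)

  define P where "P = {X\<in>\<F>. excess X X = 0}"
  define Q where "Q = {X\<in>\<F>. excess X X = 1}"
  define W where "W = {X\<in>\<F>. 2 \<le> excess X X}"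
  have PQW: "\<F> = P \<union> Q \<union> W" "P \<inter> Q = {}" "(P \<union> Q) \<inter> W = {}"
    unfolding P_def Q_def W_def by auto
  have fin: "finite P" "finite Q" "finite W"
    using finite_F unfolding P_def Q_def W_def by auto
  have rowP: "(\<Sum>Y\<in>\<F>-{X}. excess X Y) = nat d" if "X \<in> P" for X
  proof -
    have "X \<in> \<F>" "degree \<B> X = b s" using that excess_self[of X] by (auto simp: P_def)
    then have "int (\<Sum>Y\<in>\<F>-{X}. excess X Y) = d"
      unfolding d_T by (subst excess_row_sum) auto
    then show ?thesis by linarith
  qed
  have rowQ: "(\<Sum>Y\<in>\<F>-{X}. excess X Y) = nat d'" if "X \<in> Q" for X
  proof -
    have "X \<in> \<F>" "degree \<B> X = b s + 1" using that excess_self[of X] by (auto simp: Q_def)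
    then have "int (\<Sum>Y\<in>\<F>-{X}. excess X Y) = d'"
      unfolding d'_eq d_T by (subst excess_row_sum) (auto simp: algebra_simps)
    then show ?thesis by linarith
  qed

  have nat_d: "real (nat d) = d" "real (nat d') = d'"
    using d0 d'_ge iii[of s] by simp_all
  interpret excess_graph P Q excess "a s" "nat d" "nat d'" "size \<B>"
  proof unfold_locales
    show "finite Q" by (fact fin)
    show "excess X Y = excess Y X" for X Y by (rule excess_sym)
    show "real (nat d) < real_of_int (a s)" using nat_d \<open>d < a s\<close> by linarith
    show "real_of_int (a s) + 1 + real (nat d) \<le> real (nat d')" using nat_d d'_ge by linarith
    show "(\<Sum>Y\<in>Q. excess X Y) \<le> nat d" if "X \<in> P" for X
    proof -
      have "Q \<subseteq> \<F> - {X}" using that PQW by auto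
      then show ?thesis
        unfolding rowP[OF that, symmetric] using finite_F by (intro sum_mono2) auto
    qed
    show "(\<Sum>Z\<in>Q-{Y}. excess Y Z) + (\<Sum>X\<in>P. excess Y X) \<le> nat d'" if "Y \<in> Q" for Y
    proof -
      have "(\<Sum>Z\<in>Q-{Y}. excess Y Z) + (\<Sum>X\<in>P. excess Y X) = (\<Sum>X\<in>(Q-{Y})\<union>P. excess Y X)"
        using fin PQW by (intro sum.union_disjoint[symmetric]) auto
      also have "\<dots> \<le> (\<Sum>X\<in>\<F>-{Y}. excess Y X)"
        using finite_F that PQW by (intro sum_mono2) auto
      finally show ?thesis using rowQ[OF that] by simp
    qed
    show "card P + card S \<le> size \<B>"
      if "S \<subseteq> Q" "\<And>y. y \<in> S \<Longrightarrow> load (nat d / a s) excess P S y < real_of_int (a s) + 1" for S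
      using that rowP d0 \<open>d < a s\<close>
      by (intro card_light_le_size[of P S "nat d"]) (auto simp: P_def Q_def)
  qed

  have A: "real_of_int d \<ge> 0" "real_of_int d < a s" "real_of_int (a s) + 1 + real_of_int d \<le> d'"
    using d0 \<open>d < a s\<close> d'_ge by linarith+
  \<comment> \<open>the bounds are stated for natural \<open>d\<close> and \<open>d'\<close>, the theorem for integers\<close>
  note of_nat_hom = of_nat_power of_nat_mult of_nat_add of_nat_1 of_nat_numeral nat_d
  have "\<alpha> * card P + \<beta> * card Q \<le> size \<B> \<and> \<beta> \<le> \<alpha> / 2 \<and> 0 \<le> \<alpha>"
    using cases
  proof (elim disjE conjE)
    assume \<alpha>: "\<alpha> = 1 - real_of_int (d ^ 2) / real_of_int (2 * a s * (a s + 1))"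
      and \<beta>: "\<beta> = real_of_int (a s + 2) / real_of_int (2 * (d' + 1))"
    have eqs: "\<alpha> = 1 - (real_of_int d)\<^sup>2 / (2 * real_of_int (a s) * (real_of_int (a s) + 1))"
      "\<beta> = (real_of_int (a s) + 2) / (2 * (real_of_int d' + 1))"
      by (simp_all add: \<alpha> \<beta>)
    show ?thesis using bound_a[unfolded of_nat_hom] ratio_a[OF A] unfolding eqs by blast
  next
    assume \<alpha>: "\<alpha> = 1"
      and \<beta>: "\<beta> = 1 - real_of_int (d * d') / real_of_int (a s * (a s + 1))"
      and half: "real_of_int (a s) / 2 \<le> real_of_int d"
    have eq: "\<beta> = 1 - real_of_int d * real_of_int d' / (real_of_int (a s) * (real_of_int (a s) + 1))"
      by (simp add: \<beta>)
    have "0 < real_of_int (a s)" using A by linarith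
    then show ?thesis
      using bound_b[unfolded of_nat_hom, OF half] ratio_b[OF _ half A(3)]
      unfolding \<alpha> eq by (simp only: mult_1) simp
  next
    assume \<alpha>: "\<alpha> = 1"
      and \<beta>: "\<beta> = sqrt (real_of_int (d * (a s + 2)) / real_of_int ((a s + 1) * (a s - d)))
         - real_of_int (d * (d' + 1)) / real_of_int (2 * (a s + 1) * (a s - d))"
      and half: "real_of_int d < real_of_int (a s) / 2"
    have eq: "\<beta> = sqrt (real_of_int d * (real_of_int (a s) + 2)
          / ((real_of_int (a s) + 1) * (real_of_int (a s) - real_of_int d)))
        - real_of_int d * (real_of_int d' + 1)
          / (2 * (real_of_int (a s) + 1) * (real_of_int (a s) - real_of_int d))"
      by (simp add: \<beta>)
    show ?thesis
      using bound_c[unfolded of_nat_hom, OF half] ratio_c[OF A]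
      unfolding \<alpha> eq by (simp only: mult_1) simp
  qed
  then have rank: "\<alpha> * card P + \<beta> * card Q \<le> size \<B>" and \<beta>\<alpha>: "\<beta> \<le> \<alpha> / 2" "0 \<le> \<alpha>" by auto
  have cardF: "v choose s = card P + card Q + card W"
  proof -
    have "v choose s = card \<F>" unfolding \<F>_def using V by (simp add: n_subsets)
    then show ?thesis using PQW fin by (simp add: card_Un_disjoint)
  qed
  have total: "b s * (v choose s) + card Q + 2 * card W \<le> size \<B> * (k choose s)"
  proof -
    have "size \<B> * (k choose s) = (\<Sum>X\<in>\<F>. degree \<B> X)"
      using sum_degree_subsets[OF V(1) blocks, where X = "{}" and s = s] by (simp add: degree_def \<F>_def)
    also have "\<dots> = (\<Sum>X\<in>\<F>. b s) + (\<Sum>X\<in>\<F>. excess X X)"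
      by (subst sum.distrib[symmetric]) (intro sum.cong refl excess_self)
    also have "(\<Sum>X\<in>\<F>. excess X X) = (\<Sum>X\<in>P. excess X X) + (\<Sum>X\<in>Q. excess X X) + (\<Sum>X\<in>W. excess X X)"
      using PQW fin by (simp add: sum.union_disjoint)
    also have "(\<Sum>X\<in>Q. excess X X) = card Q" by (simp add: Q_def)
    finally have "size \<B> * (k choose s) = b s * (v choose s) + (\<Sum>X\<in>P. excess X X) + card Q + (\<Sum>X\<in>W. excess X X)"
      using V by (simp add: \<F>_def n_subsets)
    moreover have "(\<Sum>X\<in>W. 2) \<le> (\<Sum>X\<in>W. excess X X)"
      by (intro sum_mono) (auto simp: W_def)
    ultimately show ?thesis by simp
  qed
  have "CB v k s (b s) \<alpha> \<beta> \<le> size \<B>"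
    by (rule CB_le[OF rank \<beta>\<alpha> total cardF])
  then show ?thesis unfolding size[symmetric] by (simp add: ceiling_le_iff)
qed

end
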